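(* Let $P(\mathbf{D})y=N(\mathbf{D})u$ be a minimal and controllable linear time invariant dynamical system in input/output form, with $P\in\mathbb{R}^{g\times g}[\xi]$, $\det P\neq 0$, $N\in\mathbb{R}^{g\times(q-g)}[\xi]$, $g<q$, $P^{-1}N$ proper, input $u$ (with $q-g$ components), output $y$ (with $g$ components), and $\mathbf{D}$ the differentiation operator. Let $\mathcal{T}$ be a type whose associated linear operator $\mathbf{Op}$ is a polynomial in $\mathbf{D}$ with real coefficients, and suppose there exist input/output pairs $(u,y)$ of the system with $\mathbf{Op}\,u=0$ and $\mathbf{Op}\,y=0$. Let $\|\cdot\|_{\mathbf{Q}}$ be a Sobolev norm with self-adjoint operator $\mathbf{Q}$. Let $$U=\begin{bmatrix} U_{11} & U_{12} \\ U_{21} & U_{22} \end{bmatrix}\in\mathbb{R}^{q\times q}[\xi]$$ be a unimodular matrix such that $\begin{bmatrix}N&P\end{bmatrix}U=\begin{bmatrix}I&O\end{bmatrix}$ (with $U_{12}$ of size $(q-g)\times(q-g)$ and $U_{22}$ of size $g\times(q-g)$), and write $\mathbf{U}_{ij}=U_{ij}(\mathbf{D})$. Then the trajectories $(u,y)$ in the Gluskabi extension of $\mathcal{T}$ with respect to $\|\cdot\|_{\mathbf{Q}}$, restricted to the interval $[a,b]$, are given by the equations $$\left(\mathbf{U}_{12}^*\,{\mathbf{Op}^u}^*\,\mathbf{Q}^u\,\mathbf{Op}^u\,\mathbf{U}_{12}+\mathbf{U}_{22}^*\,{\mathbf{Op}^y}^*\,\mathbf{Q}^y\,\mathbf{Op}^y\,\mathbf{U}_{22}\right)\eta=0,$$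 $$-\mathbf{U}_{12}\,\eta=u,\qquad \mathbf{U}_{22}\,\eta=y,$$ where $\eta$ is a function on $[a,b]$ with values in $\mathbb{R}^{q-g}$.
   Context: The time axis is $\mathbb{R}$. The base behavior is $\mathcal{B}_0=\{w=(u,y)\in C^\infty(\mathbb{R},\mathbb{R}^q): P(\mathbf{D})y=N(\mathbf{D})u\}$; both the trajectories to be connected and the connections must lie in $\mathcal{B}_0$ (i.e. on $[a,b]$ connections satisfy the system equation). Controllable (behavioral sense): for any two trajectories $w_1,w_2$ of the system there are $\tau\ge0$ and a trajectory $w$ of the system with $w(t)=w_1(t)$ for $t\le0$ and $w(t)=w_2(t-\tau)$ for $t\ge\tau$; equivalently, the rank of $\begin{bmatrix}P(s)&-N(s)\end{bmatrix}$ is the same for all $s\in\mathbb{C}$. Minimal means that $\begin{bmatrix}P&-N\end{bmatrix}$ has full row rank (as a polynomial matrix). A unimodular matrix is a square polynomial matrix whose determinant is a nonzero constant. Type: $\mathcal{T}$ is the set of $w=(u,y)\in\mathcal{B}_0$ with $\mathbf{Op}\,w=0$, where the scalar operator $\mathbf{Op}$ acts componentwise on vector functions. $\mathbf{Op}^u,\mathbf{Op}^y$ denote the componentwise extensions of $\mathbf{Op}$ to functions with values in $\mathbb{R}^{q-g}$ and $\mathbb{R}^{g}$ respectively, and $\mathbf{Q}^u,\mathbf{Q}^y$ the analogous componentwise extensions of $\mathbf{Q}$. Sobolev norm: $\|e\|_{\mathbf{Q}}^2=\langle\mathbf{Q}e,e\rangle$ with $\langle\cdot,\cdot\rangle$ the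 $L^2([a,b])$ inner product (extended to vector functions by summing over components) and $\mathbf{Q}=W(-\mathbf{D}^2)$, $W(\xi)=1+\xi+\dots+\xi^k$, $k$ the order of the norm ($k=0$ gives the $L^2$ norm). Adjoints are formal adjoints: for a real polynomial matrix $M$, $M(\mathbf{D})^*=M^*(\mathbf{D})$ with $M^*(s)=M(-s)^T$. Gluskabi extension: the set of trajectories $w=(u,y)$ such that there are $w_1,w_2\in\mathcal{T}$ with $w=w_1$ on $(-\infty,a]$, $w=w_2$ on $[b,\infty)$, and on $[a,b]$ the pair $(u,y)$ minimizes $\tfrac12\langle\mathbf{Q}^u\mathbf{Op}^u u,\mathbf{Op}^u u\rangle+\tfrac12\langle\mathbf{Q}^y\mathbf{Op}^y y,\mathbf{Op}^y y\rangle$ among pairs satisfying $P(\mathbf{D})y=N(\mathbf{D})u$ on $[a,b]$ and matching $w_1$ at $t=a$ and $w_2$ at $t=b$, together with an appropriate number of derivatives (so admissible variations $\delta u,\delta y$ and the appropriate number of their derivatives vanish at $a$ and $b$). *)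

theory Defs
  imports
    "HOL-Analysis.Analysis"
    "HOL-Computational_Algebra.Polynomial_Factorial"
begin

section \<open>Polynomial differential operators\<close>

text \<open>
  All derivatives are taken within a set \<open>S\<close>, which is either \<open>UNIV\<close> (the whole time axis) or
  a compact interval \<open>{a..b}\<close> with \<open>a < b\<close>; in the second case they are one-sided at the end
  points, and at points of \<open>S\<close> they only depend on the restriction of the function to \<open>S\<close>.
\<close>

definition nderiv :: "real set \<Rightarrow> nat \<Rightarrow> (real \<Rightarrow> 'a::real_normed_vector) \<Rightarrow> real \<Rightarrow> 'a" where
  "nderiv S n f = ((\<lambda>h t. vector_derivative h (at t within S)) ^^ n) f"

definition smooth_on :: "real set \<Rightarrow> (real \<Rightarrow> 'a::real_normed_vector) \<Rightarrow> bool" where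
  "smooth_on S f \<longleftrightarrow> (\<forall>n. \<forall>t\<in>S. nderiv S n f differentiable (at t within S))"

definition pdiff :: "real set \<Rightarrow> real poly \<Rightarrow> (real \<Rightarrow> real) \<Rightarrow> real \<Rightarrow> real" where
  "pdiff S p f t = (\<Sum>i\<le>degree p. coeff p i * nderiv S i f t)"

text \<open>
  For a scalar polynomial \<open>p\<close>, the componentwise extension of \<open>p(D)\<close> to vector functions is
  \<open>mdiff S (mat p)\<close>, where \<open>mat p\<close> is the diagonal matrix with all diagonal entries \<open>p\<close>.
\<close>

definition mdiff ::
  "real set \<Rightarrow> real poly ^ 'n ^ 'r \<Rightarrow> (real \<Rightarrow> real ^ 'n) \<Rightarrow> real \<Rightarrow> real ^ 'r" where
  "mdiff S M f t = (\<chi> i. \<Sum>j\<in>UNIV. pdiff S (M $ i $ j) (\<lambda>s. f s $ j) t)"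

text \<open>Formal adjoint: \<open>M(-s)\<close> transposed.\<close>

definition poly_adjoint :: "real poly ^ 'n ^ 'r \<Rightarrow> real poly ^ 'r ^ 'n" where
  "poly_adjoint M = (\<chi> i j. pcompose (M $ j $ i) [:0, -1:])"


section \<open>Polynomial and rational matrices\<close>

definition block_row :: "'a ^ 'm ^ 'r \<Rightarrow> 'a ^ 'n ^ 'r \<Rightarrow> 'a ^ ('m + 'n) ^ 'r" where
  "block_row A B = (\<chi> i j. case j of Inl k \<Rightarrow> A $ i $ k | Inr k \<Rightarrow> B $ i $ k)"

definition block_matrix ::
  "'a ^ 'm ^ 'r \<Rightarrow> 'a ^ 'n ^ 'r \<Rightarrow> 'a ^ 'm ^ 's \<Rightarrow> 'a ^ 'n ^ 's \<Rightarrow> 'a ^ ('m + 'n) ^ ('r + 's)" where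
  "block_matrix A B C D =
     (\<chi> i. case i of Inl k \<Rightarrow> block_row A B $ k | Inr k \<Rightarrow> block_row C D $ k)"

text \<open>
  Row and column index types may differ, as they do for a \<open>q \<times> q\<close> matrix whose rows and columns
  are partitioned differently. Squareness is the existence of the bijection \<open>e\<close>; another choice
  of \<open>e\<close> changes the determinant only by a sign.
\<close>

definition unimodular :: "real poly ^ 'n ^ 'r \<Rightarrow> bool" where
  "unimodular M \<longleftrightarrow>
     (\<exists>e :: 'r \<Rightarrow> 'n. bij e \<and> (\<exists>c. c \<noteq> 0 \<and> det (\<chi> i j. M $ i $ e j) = [:c:]))"

definition to_rational :: "real poly ^ 'n ^ 'r \<Rightarrow> real poly fract ^ 'n ^ 'r" where
  "to_rational M = (\<chi> i j. to_fract (M $ i $ j))"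

definition proper_rational :: "real poly fract \<Rightarrow> bool" where
  "proper_rational r \<longleftrightarrow> (\<exists>p q. q \<noteq> 0 \<and> r = Fract p q \<and> degree p \<le> degree q)"

definition proper_transfer :: "real poly ^ 'g ^ 'g \<Rightarrow> real poly ^ 'm ^ 'g \<Rightarrow> bool" where
  "proper_transfer P N \<longleftrightarrow>
     (\<forall>i j. proper_rational ((matrix_inv (to_rational P) ** to_rational N) $ i $ j))"

definition minimal_system :: "real poly ^ 'g ^ 'g \<Rightarrow> real poly ^ 'm ^ 'g \<Rightarrow> bool" where
  "minimal_system P N \<longleftrightarrow> rank (to_rational (block_row P (- N))) = CARD('g)"


section \<open>Systems, controllability and types\<close>

type_synonym ('m, 'g) trajectory = "(real \<Rightarrow> real ^ 'm) \<times> (real \<Rightarrow> real ^ 'g)"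

definition behavior_on ::
  "real set \<Rightarrow> real poly ^ 'g ^ 'g \<Rightarrow> real poly ^ 'm ^ 'g \<Rightarrow> ('m, 'g) trajectory set" where
  "behavior_on S P N =
     {(u, y). smooth_on S u \<and> smooth_on S y \<and> (\<forall>t\<in>S. mdiff S P y t = mdiff S N u t)}"

definition controllable :: "('m, 'g) trajectory set \<Rightarrow> bool" where
  "controllable B \<longleftrightarrow>
     (\<forall>(u1, y1)\<in>B. \<forall>(u2, y2)\<in>B. \<exists>\<tau>\<ge>0. \<exists>(u, y)\<in>B.
        (\<forall>t\<le>0. u t = u1 t \<and> y t = y1 t) \<and>
        (\<forall>t\<ge>\<tau>. u t = u2 (t - \<tau>) \<and> y t = y2 (t - \<tau>)))"

definition op_type ::
  "real poly ^ 'g ^ 'g \<Rightarrow> real poly ^ 'm ^ 'g \<Rightarrow> real poly \<Rightarrow> ('m, 'g) trajectory set" where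
  "op_type P N p =
     {(u, y)\<in>behavior_on UNIV P N. \<forall>t. mdiff UNIV (mat p) u t = 0 \<and> mdiff UNIV (mat p) y t = 0}"


section \<open>The Gluskabi extension\<close>

text \<open>
  \<open>sobolev_poly k\<close> is the polynomial \<open>W(- s\<^sup>2)\<close> with \<open>W(x) = 1 + x + \<dots> + x ^ k\<close>.
\<close>

definition sobolev_poly :: "nat \<Rightarrow> real poly" where
  "sobolev_poly k = pcompose (\<Sum>i\<le>k. monom 1 i) [:0, 0, -1:]"

definition cost :: "real \<Rightarrow> real \<Rightarrow> nat \<Rightarrow> real poly \<Rightarrow> ('m::finite, 'g::finite) trajectory \<Rightarrow> real" where
  "cost a b k p = (\<lambda>(u, y).
     let e = mdiff {a..b} (mat p) u; e' = mdiff {a..b} (mat p) y in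
       1/2 * integral {a..b} (\<lambda>t. mdiff {a..b} (mat (sobolev_poly k)) e t \<bullet> e t) +
       1/2 * integral {a..b} (\<lambda>t. mdiff {a..b} (mat (sobolev_poly k)) e' t \<bullet> e' t))"

text \<open>
  At \<open>t\<close>, the \<open>i\<close>-th component of \<open>f\<close> on \<open>S\<close> has the same value and the same derivatives up to
  order \<open>r i\<close> as that of \<open>g\<close> on the whole line.
\<close>

definition contact ::
  "('n \<Rightarrow> nat) \<Rightarrow> real set \<Rightarrow> real \<Rightarrow> (real \<Rightarrow> real ^ 'n) \<Rightarrow> (real \<Rightarrow> real ^ 'n) \<Rightarrow> bool" where
  "contact r S t f g \<longleftrightarrow>
     (\<forall>i. \<forall>j\<le>r i. nderiv S j (\<lambda>s. f s $ i) t = nderiv UNIV j (\<lambda>s. g s $ i) t)"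

definition matches ::
  "real \<Rightarrow> real \<Rightarrow> ('m \<Rightarrow> nat) \<Rightarrow> ('g \<Rightarrow> nat) \<Rightarrow>
   ('m::finite, 'g::finite) trajectory \<Rightarrow> ('m::finite, 'g::finite) trajectory \<Rightarrow> ('m::finite, 'g::finite) trajectory \<Rightarrow> bool" where
  "matches a b ru ry = (\<lambda>(u1, y1) (u2, y2) (u, y).
     contact ru {a..b} a u u1 \<and> contact ry {a..b} a y y1 \<and>
     contact ru {a..b} b u u2 \<and> contact ry {a..b} b y y2)"

definition glued ::
  "real \<Rightarrow> real \<Rightarrow> ('m::finite, 'g::finite) trajectory \<Rightarrow> ('m::finite, 'g::finite) trajectory \<Rightarrow> ('m::finite, 'g::finite) trajectory \<Rightarrow> bool" where
  "glued a b = (\<lambda>(u1, y1) (u2, y2) (u, y).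
     (\<forall>t\<le>a. u t = u1 t \<and> y t = y1 t) \<and> (\<forall>t\<ge>b. u t = u2 t \<and> y t = y2 t))"

definition optimal_connection ::
  "real \<Rightarrow> real \<Rightarrow> ('m \<Rightarrow> nat) \<Rightarrow> ('g \<Rightarrow> nat) \<Rightarrow> nat \<Rightarrow> real poly ^ 'g ^ 'g \<Rightarrow> real poly ^ 'm ^ 'g \<Rightarrow>
   real poly \<Rightarrow> ('m::finite, 'g::finite) trajectory \<Rightarrow> ('m::finite, 'g::finite) trajectory \<Rightarrow> ('m::finite, 'g::finite) trajectory \<Rightarrow> bool" where
  "optimal_connection a b ru ry k P N p w1 w2 w \<longleftrightarrow>
     w \<in> behavior_on {a..b} P N \<and> matches a b ru ry w1 w2 w \<and>
     (\<forall>v\<in>behavior_on {a..b} P N. matches a b ru ry w1 w2 v \<longrightarrow> cost a b k p w \<le> cost a b k p v)"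

definition gluskabi_extension ::
  "real \<Rightarrow> real \<Rightarrow> ('m \<Rightarrow> nat) \<Rightarrow> ('g \<Rightarrow> nat) \<Rightarrow> nat \<Rightarrow> real poly ^ 'g ^ 'g \<Rightarrow> real poly ^ 'm ^ 'g \<Rightarrow>
   real poly \<Rightarrow> ('m::finite, 'g::finite) trajectory set" where
  "gluskabi_extension a b ru ry k P N p =
     {w. \<exists>w1\<in>op_type P N p. \<exists>w2\<in>op_type P N p.
           glued a b w1 w2 w \<and> optimal_connection a b ru ry k P N p w1 w2 w}"

text \<open>
  The number of derivatives that has to be matched at the end points. Matching all derivatives of
  order less than \<open>degree p + k\<close> makes the boundary terms vanish when \<open>p(D)\<close> and the Sobolev
  operator are integrated by parts; matching all derivatives of order less than the degrees in the
  corresponding column of \<open>M\<close> (where \<open>M\<close> is \<open>N\<close> for the input and \<open>P\<close> for the output) does the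
  same for the constraint.
\<close>

definition enough_derivatives ::
  "nat \<Rightarrow> real poly \<Rightarrow> real poly ^ 'n ^ 'r \<Rightarrow> ('n \<Rightarrow> nat) \<Rightarrow> bool" where
  "enough_derivatives k p M r \<longleftrightarrow>
     (\<forall>j. degree p + k \<le> Suc (r j) \<and> (\<forall>i. degree (M $ i $ j) \<le> Suc (r j)))"

end

theory Submission
  imports Defs
begin

text \<open>
  Write a trajectory as \<open>w = (- u, y)\<close> and put \<open>R = [N P]\<close>, so that the system is \<open>R(D) w = 0\<close>. If \<open>L\<close>
  and \<open>K\<close> are the block columns of \<open>U\<close>, then \<open>R K = 0\<close> and \<open>L R + K H = 1\<close> for the second block row
  \<open>H\<close> of the inverse of \<open>U\<close>. Hence the trajectories on \<open>[a, b]\<close> are exactly the \<open>K(D) \<eta>\<close>, with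
  \<open>\<eta> = H(D) w\<close>, and the equation for \<open>\<eta>\<close> says \<open>K\<^sup>* g = 0\<close>, where \<open>g = Op\<^sup>* Q Op w\<close>. The cost is a quadratic
  function along admissible variations \<open>d\<close>, with linear term \<open>\<langle>g, d\<rangle>\<close> and nonnegative quadratic term,
  because \<open>Op w\<close> and \<open>Op d\<close> vanish to order \<open>k\<close> at the end points.
  If \<open>K\<^sup>* g = 0\<close>, then \<open>g = R\<^sup>* L\<^sup>* g\<close> is orthogonal to every admissible \<open>d\<close>. Conversely, the
  variation \<open>d = K(D) (\<phi> K\<^sup>* g)\<close>, for a weight \<open>\<phi>\<close> that is positive inside \<open>[a, b]\<close> and vanishes to high
  order at the end points, forces \<open>\<langle>\<phi> K\<^sup>* g, K\<^sup>* g\<rangle> = 0\<close>.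
\<close>

section \<open>Derivatives within a set\<close>

lemma nderiv_0 [simp]: "nderiv S 0 f = f"
  by (simp add: nderiv_def)

lemma nderiv_Suc: "nderiv S (Suc n) f = (\<lambda>t. vector_derivative (nderiv S n f) (at t within S))"
  by (simp add: nderiv_def)

lemma nderiv_add_index: "nderiv S (m + n) f = nderiv S m (nderiv S n f)"
  by (simp add: nderiv_def funpow_add)

lemma smooth_on_nderiv: "smooth_on S f \<Longrightarrow> smooth_on S (nderiv S n f)"
  unfolding smooth_on_def by (simp flip: nderiv_add_index)

lemma nderiv_has_vector_derivative:
  assumes "smooth_on S f" "t \<in> S"
  shows "(nderiv S n f has_vector_derivative nderiv S (Suc n) f t) (at t within S)"
  using assms by (simp add: smooth_on_def nderiv_Suc flip: vector_derivative_works)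

lemma smooth_on_imp_continuous_on: "smooth_on S f \<Longrightarrow> continuous_on S f"
  using nderiv_has_vector_derivative[of S f _ 0] has_vector_derivative_continuous
  by (metis continuous_on_eq_continuous_within nderiv_0)

section \<open>Dependence of scalar operators on the polynomial\<close>

lemma pdiff_eq_sum:
  assumes "degree q \<le> n"
  shows "pdiff S q f t = (\<Sum>i\<le>n. coeff q i * nderiv S i f t)"
  unfolding pdiff_def using assms
  by (intro sum.mono_neutral_left) (auto simp: coeff_eq_0)

lemma pdiff_0 [simp]: "pdiff S 0 f t = 0"
  by (simp add: pdiff_def)

lemma pdiff_1 [simp]: "pdiff S 1 f t = f t"
  by (simp add: pdiff_def)

lemma pdiff_poly_add: "pdiff S (q + r) f t = pdiff S q f t + pdiff S r f t"
proof -
  let ?n = "max (degree q) (degree r)"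
  have "degree (q + r) \<le> ?n" by (rule degree_add_le_max)
  then show ?thesis
    using pdiff_eq_sum[of "q + r" ?n S f t] pdiff_eq_sum[of q ?n S f t] pdiff_eq_sum[of r ?n S f t]
    by (simp add: sum.distrib algebra_simps)
qed

lemma pdiff_poly_smult: "pdiff S (smult c q) f t = c * pdiff S q f t"
  using pdiff_eq_sum[of "smult c q" "degree q" S f t]
  by (simp add: pdiff_def degree_smult_le sum_distrib_left algebra_simps)

lemma pdiff_poly_sum: "pdiff S (\<Sum>j\<in>A. q j) f t = (\<Sum>j\<in>A. pdiff S (q j) f t)"
  by (induction A rule: infinite_finite_induct) (simp_all add: pdiff_poly_add)

text \<open>Once the constant coefficient is split off, the rest of the polynomial acts on the
  derivative of \<open>f\<close>; this recursion drives the induction for products of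
  polynomials.\<close>

lemma pdiff_pCons: "pdiff S (pCons c q) f t = c * f t + pdiff S q (nderiv S 1 f) t"
proof -
  have shift: "nderiv S (Suc i) f = nderiv S i (nderiv S 1 f)" for i
    by (metis Suc_eq_plus1 nderiv_add_index)
  have "pdiff S (pCons c q) f t = (\<Sum>i\<le>Suc (degree q). coeff (pCons c q) i * nderiv S i f t)"
    by (rule pdiff_eq_sum) (rule degree_pCons_le)
  also have "\<dots> = c * f t + (\<Sum>i\<le>degree q. coeff q i * nderiv S (Suc i) f t)"
    by (subst sum.atMost_Suc_shift) simp
  finally show ?thesis by (simp only: pdiff_def shift)
qed

text \<open>Without isolated points, derivatives within \<open>S\<close> are unique, so
  \<open>vector_derivative\<close> can be computed from any \<open>has_vector_derivative\<close>
  fact. The calculus is thus set up once for the whole line and for \<open>{a..b}\<close>.\<close>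

locale time_domain =
  fixes S :: "real set"
  assumes not_bot: "t \<in> S \<Longrightarrow> at t within S \<noteq> bot"
begin

text \<open>Smoothness and all derivatives are read off from a sequence of successive derivatives; the
  closure properties below all follow from this.\<close>

lemma nderiv_unique:
  assumes g0: "\<And>t. t \<in> S \<Longrightarrow> f t = g 0 t"
    and g: "\<And>n t. t \<in> S \<Longrightarrow> (g n has_vector_derivative g (Suc n) t) (at t within S)"
  shows "smooth_on S f" and "t \<in> S \<Longrightarrow> nderiv S n f t = g n t"
proof -
  have *: "\<forall>t\<in>S. nderiv S n f t = g n t" for n
  proof (induction n)
    case 0
    then show ?case using g0 by simp
  next
    case (Suc n)
    have "(nderiv S n f has_vector_derivative g (Suc n) t) (at t within S)" if "t \<in> S" for t
      using has_vector_derivative_transform[OF that _ g[OF that, of n]] Suc by blast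
    then show ?case
      using not_bot by (simp add: nderiv_Suc vector_derivative_within)
  qed
  show "smooth_on S f"
    unfolding smooth_on_def
  proof (intro allI ballI)
    fix n t assume t: "t \<in> S"
    have "(nderiv S n f has_vector_derivative g (Suc n) t) (at t within S)"
      using has_vector_derivative_transform[OF t _ g[OF t, of n]] * by blast
    then show "nderiv S n f differentiable (at t within S)"
      by (rule differentiableI_vector)
  qed
  show "t \<in> S \<Longrightarrow> nderiv S n f t = g n t" using * by blast
qed

section \<open>Closure properties of smooth functions\<close>

lemma smooth_cong:
  assumes "smooth_on S f" "\<And>t. t \<in> S \<Longrightarrow> h t = f t"
  shows "smooth_on S h" and "t \<in> S \<Longrightarrow> nderiv S n h t = nderiv S n f t"
  using nderiv_unique(1)[of h "\<lambda>n. nderiv S n f"] nderiv_unique(2)[of h "\<lambda>n. nderiv S n f" t n]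
    nderiv_has_vector_derivative[OF assms(1)] assms(2) by auto

lemma smooth_add:
  assumes "smooth_on S f" "smooth_on S h"
  shows "smooth_on S (\<lambda>t. f t + h t)"
    and "t \<in> S \<Longrightarrow> nderiv S n (\<lambda>t. f t + h t) t = nderiv S n f t + nderiv S n h t"
  using nderiv_unique(1)[of "\<lambda>t. f t + h t" "\<lambda>n t. nderiv S n f t + nderiv S n h t"] nderiv_unique(2)[of "\<lambda>t. f t + h t" "\<lambda>n t. nderiv S n f t + nderiv S n h t" t n]
    has_vector_derivative_add[OF nderiv_has_vector_derivative[OF assms(1)]
      nderiv_has_vector_derivative[OF assms(2)]] by auto

lemma smooth_bounded_linear:
  assumes "smooth_on S f" "bounded_linear L"
  shows "smooth_on S (\<lambda>t. L (f t))"
    and "t \<in> S \<Longrightarrow> nderiv S n (\<lambda>t. L (f t)) t = L (nderiv S n f t)"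
  using nderiv_unique(1)[of "\<lambda>t. L (f t)" "\<lambda>n t. L (nderiv S n f t)"] nderiv_unique(2)[of "\<lambda>t. L (f t)" "\<lambda>n t. L (nderiv S n f t)" t n]
    bounded_linear.has_vector_derivative[OF assms(2) nderiv_has_vector_derivative[OF assms(1)]]
  by auto

lemma smooth_const:
  "smooth_on S (\<lambda>_. c)" "t \<in> S \<Longrightarrow> nderiv S n (\<lambda>_. c) t = (if n = 0 then c else 0)"
  using nderiv_unique(1)[of "\<lambda>_. c" "\<lambda>n _. if n = 0 then c else 0"] nderiv_unique(2)[of "\<lambda>_. c" "\<lambda>n _. if n = 0 then c else 0" t n] by auto

lemma smooth_ident: "smooth_on S (\<lambda>t. t)"
  by (rule nderiv_unique(1)[of _ "\<lambda>n t. if n = 0 then t else if n = 1 then 1 else 0"])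
    (auto intro: derivative_eq_intros)

lemma smooth_cmult:
  fixes f :: "real \<Rightarrow> real"
  assumes "smooth_on S f"
  shows "smooth_on S (\<lambda>t. c * f t)"
    and "t \<in> S \<Longrightarrow> nderiv S n (\<lambda>t. c * f t) t = c * nderiv S n f t"
  using smooth_bounded_linear[OF assms bounded_linear_mult_right] by auto

lemmas smooth_uminus =
  smooth_bounded_linear[OF _ bounded_linear_minus[OF bounded_linear_ident]]

lemma smooth_diff:
  assumes "smooth_on S f" "smooth_on S h"
  shows "smooth_on S (\<lambda>t. f t - h t)"
    and "t \<in> S \<Longrightarrow> nderiv S n (\<lambda>t. f t - h t) t = nderiv S n f t - nderiv S n h t"
  using smooth_add[OF assms(1) smooth_uminus(1)[OF assms(2)]] smooth_uminus(2)[OF assms(2)] by auto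

lemma smooth_sum:
  assumes "\<And>j. j \<in> A \<Longrightarrow> smooth_on S (f j)"
  shows "smooth_on S (\<lambda>t. \<Sum>j\<in>A. f j t)"
    and "t \<in> S \<Longrightarrow> nderiv S n (\<lambda>t. \<Sum>j\<in>A. f j t) t = (\<Sum>j\<in>A. nderiv S n (f j) t)"
  using nderiv_unique(1)[of "\<lambda>t. \<Sum>j\<in>A. f j t" "\<lambda>n t. \<Sum>j\<in>A. nderiv S n (f j) t"] nderiv_unique(2)[of "\<lambda>t. \<Sum>j\<in>A. f j t" "\<lambda>n t. \<Sum>j\<in>A. nderiv S n (f j) t" t n]
    has_vector_derivative_sum[of A "\<lambda>j. nderiv S _ (f j)", OF nderiv_has_vector_derivative[OF assms]]
  by auto

lemma smooth_component:
  fixes f :: "real \<Rightarrow> real ^ 'n"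
  assumes "smooth_on S f"
  shows "smooth_on S (\<lambda>t. f t $ i)"
    and "t \<in> S \<Longrightarrow> nderiv S n (\<lambda>t. f t $ i) t = nderiv S n f t $ i"
  using smooth_bounded_linear[OF assms bounded_linear_vec_nth] by auto

lemma smooth_vecI:
  fixes f :: "real \<Rightarrow> real ^ 'n"
  assumes "\<And>i. smooth_on S (\<lambda>t. f t $ i)"
  shows "smooth_on S f"
proof -
  have eq: "f = (\<lambda>t. \<Sum>i\<in>UNIV. f t $ i *\<^sub>R axis i 1)"
    by (auto simp: vec_eq_iff axis_def if_distrib cong: if_cong)
  show ?thesis
    by (subst eq) (intro smooth_sum smooth_bounded_linear[OF assms] bounded_linear_scaleR_left)
qed

lemma smooth_mult:
  fixes f h :: "real \<Rightarrow> real"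
  assumes "smooth_on S f" "smooth_on S h"
  shows "smooth_on S (\<lambda>t. f t * h t)"
    and "t \<in> S \<Longrightarrow>
      nderiv S n (\<lambda>t. f t * h t) t = (\<Sum>i\<le>n. (n choose i) * nderiv S i f t * nderiv S (n - i) h t)"
proof -
  let ?g = "\<lambda>n t. \<Sum>i\<le>n. (n choose i) * nderiv S i f t * nderiv S (n - i) h t"
  have "(?g n has_vector_derivative ?g (Suc n) t) (at t within S)" if t: "t \<in> S" for n t
  proof -
    note d = nderiv_has_vector_derivative[OF assms(1) t, unfolded has_real_derivative_iff_has_vector_derivative[symmetric]]
      nderiv_has_vector_derivative[OF assms(2) t, unfolded has_real_derivative_iff_has_vector_derivative[symmetric]]
    define F where "F i = nderiv S i f t" for i
    define G where "G i = nderiv S i h t" for i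
    have "(?g n has_vector_derivative
      (\<Sum>i\<le>n. real (n choose i) * (F (Suc i) * G (n - i) + F i * G (Suc (n - i))))) (at t within S)"
      unfolding has_real_derivative_iff_has_vector_derivative[symmetric] F_def G_def
      by (rule derivative_eq_intros d refl)+ (simp add: algebra_simps)
    also have "(\<Sum>i\<le>n. real (n choose i) * (F (Suc i) * G (n - i) + F i * G (Suc (n - i)))) =
        (\<Sum>i\<le>n. real (n choose i) * (F (Suc i) * G (n - i))) +
        (\<Sum>i\<le>n. real (n choose i) * (F i * G (Suc n - i)))"
      by (simp add: ring_distribs sum.distrib Suc_diff_le)
    \<comment> \<open>The extra term \<open>i = Suc n\<close> has coefficient
      \<open>n choose Suc n = 0\<close>. It makes the range long enough to split off
      \<open>i = 0\<close> and shift, so that Pascal's rule joins the two sums.\<close>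
    also have "(\<Sum>i\<le>n. real (n choose i) * (F i * G (Suc n - i))) =
        (\<Sum>i\<le>Suc n. real (n choose i) * (F i * G (Suc n - i)))"
      by simp
    also have "\<dots> = F 0 * G (Suc n) + (\<Sum>i\<le>n. real (n choose Suc i) * (F (Suc i) * G (n - i)))"
      by (subst sum.atMost_Suc_shift) simp
    also have "(\<Sum>i\<le>n. real (n choose i) * (F (Suc i) * G (n - i))) + \<dots> =
        F 0 * G (Suc n) + (\<Sum>i\<le>n. real (Suc n choose Suc i) * (F (Suc i) * G (n - i)))"
      by (simp add: ring_distribs sum.distrib)
    also have "\<dots> = (\<Sum>i\<le>Suc n. real (Suc n choose i) * F i * G (Suc n - i))"
      by (subst sum.atMost_Suc_shift) (simp add: mult.assoc)
    finally show ?thesis by (simp add: F_def G_def)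
  qed
  then show "smooth_on S (\<lambda>t. f t * h t)" "t \<in> S \<Longrightarrow> nderiv S n (\<lambda>t. f t * h t) t = ?g n t"
    using nderiv_unique(1)[of "\<lambda>t. f t * h t" ?g] nderiv_unique(2)[of "\<lambda>t. f t * h t" ?g t n] by auto
qed

lemma smooth_pdiff:
  assumes "smooth_on S f"
  shows "smooth_on S (pdiff S q f)"
    and "t \<in> S \<Longrightarrow> nderiv S n (pdiff S q f) t = (\<Sum>i\<le>degree q. coeff q i * nderiv S (n + i) f t)"
proof -
  note s = smooth_sum[of "{..degree q}" "\<lambda>i t. coeff q i * nderiv S i f t",
      OF smooth_cmult(1)[OF smooth_on_nderiv[OF assms]]]
  have eq: "pdiff S q f = (\<lambda>t. \<Sum>i\<le>degree q. coeff q i * nderiv S i f t)"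
    by (simp add: fun_eq_iff pdiff_def)
  show "smooth_on S (pdiff S q f)" unfolding eq by (rule s)
  show "nderiv S n (pdiff S q f) t = (\<Sum>i\<le>degree q. coeff q i * nderiv S (n + i) f t)" if "t \<in> S"
    unfolding eq using s(2)[OF that, of n] smooth_cmult(2)[OF smooth_on_nderiv[OF assms] that]
    by (simp add: nderiv_add_index)
qed

section \<open>Algebra of scalar differential operators\<close>

lemma pdiff_nderiv:
  assumes "smooth_on S f" "t \<in> S"
  shows "pdiff S q (nderiv S n f) t = nderiv S n (pdiff S q f) t"
  unfolding smooth_pdiff(2)[OF assms] pdiff_def
  by (simp add: add.commute flip: nderiv_add_index)

lemma pdiff_cong:
  assumes "smooth_on S f" "\<And>t. t \<in> S \<Longrightarrow> h t = f t" "t \<in> S"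
  shows "pdiff S q h t = pdiff S q f t"
  using smooth_cong(2)[OF assms] by (simp add: pdiff_def)

lemma pdiff_add:
  assumes "smooth_on S f" "smooth_on S h" "t \<in> S"
  shows "pdiff S q (\<lambda>t. f t + h t) t = pdiff S q f t + pdiff S q h t"
  using smooth_add(2)[OF assms] by (simp add: pdiff_def algebra_simps sum.distrib)

lemma pdiff_cmult:
  assumes "smooth_on S f" "t \<in> S"
  shows "pdiff S q (\<lambda>t. c * f t) t = c * pdiff S q f t"
  using smooth_cmult(2)[OF assms] by (simp add: pdiff_def algebra_simps sum_distrib_left)

lemma pdiff_uminus:
  assumes "smooth_on S f" "t \<in> S"
  shows "pdiff S q (\<lambda>t. - f t) t = - pdiff S q f t"
  using pdiff_cmult[OF assms, of q "-1"] by simp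

lemma pdiff_sum:
  assumes "\<And>j. j \<in> A \<Longrightarrow> smooth_on S (f j)" "t \<in> S"
  shows "pdiff S q (\<lambda>t. \<Sum>j\<in>A. f j t) t = (\<Sum>j\<in>A. pdiff S q (f j) t)"
  using smooth_sum(2)[of A f, OF assms(1) assms(2)]
  by (simp add: pdiff_def sum_distrib_left) (rule sum.swap)

text \<open>The reason is that operators with constant coefficients commute with differentiation.
  \<open>f\<close> is generalized because the induction step passes to its derivative.\<close>

lemma pdiff_mult:
  assumes "smooth_on S f" "t \<in> S"
  shows "pdiff S (q * r) f t = pdiff S q (pdiff S r f) t"
  using assms
proof (induction q arbitrary: f)
  case 0
  then show ?case by simp
next
  case (pCons c q)
  have "pdiff S (pCons c q * r) f t = c * pdiff S r f t + pdiff S (q * r) (nderiv S 1 f) t"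
    by (simp add: pdiff_poly_add pdiff_poly_smult pdiff_pCons)
  also have "pdiff S (q * r) (nderiv S 1 f) t = pdiff S q (pdiff S r (nderiv S 1 f)) t"
    using pCons smooth_on_nderiv by blast
  also have "\<dots> = pdiff S q (nderiv S 1 (pdiff S r f)) t"
    using pCons.prems
    by (intro pdiff_cong smooth_on_nderiv smooth_pdiff(1) pdiff_nderiv)
  finally show ?case by (simp add: pdiff_pCons)
qed

section \<open>Matrix differential operators\<close>

lemma smooth_mdiff:
  assumes "smooth_on S f"
  shows "smooth_on S (mdiff S M f)"
  by (rule smooth_vecI) (simp add: mdiff_def smooth_sum(1) smooth_pdiff(1) smooth_component(1)[OF assms])

lemma mdiff_cong:
  fixes f h :: "real \<Rightarrow> real ^ 'n"
  assumes "smooth_on S f" "\<And>t. t \<in> S \<Longrightarrow> h t = f t" "t \<in> S"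
  shows "mdiff S M h t = mdiff S M f t"
proof -
  have "pdiff S q (\<lambda>s. h s $ i) t = pdiff S q (\<lambda>s. f s $ i) t" for q i
    using assms by (intro pdiff_cong smooth_component(1)) simp_all
  then show ?thesis by (simp add: mdiff_def)
qed

lemma mdiff_add:
  fixes f h :: "real \<Rightarrow> real ^ 'n"
  assumes "smooth_on S f" "smooth_on S h" "t \<in> S"
  shows "mdiff S M (\<lambda>t. f t + h t) t = mdiff S M f t + mdiff S M h t"
  using assms by (simp add: mdiff_def vec_eq_iff pdiff_add smooth_component(1) sum.distrib)

lemma mdiff_cmult:
  fixes f :: "real \<Rightarrow> real ^ 'n"
  assumes "smooth_on S f" "t \<in> S"
  shows "mdiff S M (\<lambda>t. c *\<^sub>R f t) t = c *\<^sub>R mdiff S M f t"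
  using assms by (simp add: mdiff_def vec_eq_iff pdiff_cmult smooth_component(1) sum_distrib_left)

lemma mdiff_mult:
  assumes "smooth_on S f" "t \<in> S"
  shows "mdiff S (A ** B) f t = mdiff S A (mdiff S B f) t"
proof -
  note c = smooth_component(1)[OF assms(1)]
  have "(\<Sum>k\<in>UNIV. pdiff S (\<Sum>j\<in>UNIV. A $ i $ j * B $ j $ k) (\<lambda>s. f s $ k) t) =
      (\<Sum>j\<in>UNIV. pdiff S (A $ i $ j) (\<lambda>s. \<Sum>k\<in>UNIV. pdiff S (B $ j $ k) (\<lambda>s. f s $ k) s) t)" for i
    by (simp add: pdiff_sum pdiff_poly_sum pdiff_mult smooth_pdiff(1) c assms(2))
      (rule sum.swap)
  then show ?thesis
    by (simp add: mdiff_def matrix_matrix_mult_def)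
qed

end

lemma mdiff_poly_add: "mdiff S (A + B) f t = mdiff S A f t + mdiff S B f t"
  by (simp add: mdiff_def vec_eq_iff pdiff_poly_add sum.distrib)

lemma mdiff_0 [simp]: "mdiff S 0 f t = 0"
  by (simp add: mdiff_def vec_eq_iff)

lemma mdiff_mat: "mdiff S (mat q) f t $ i = pdiff S q (\<lambda>s. f s $ i) t"
  by (simp add: mdiff_def mat_def if_distrib[of "\<lambda>q. pdiff S q _ t"] cong: if_cong)

lemma mdiff_mat_1 [simp]: "mdiff S (mat 1) f t = f t"
  by (simp add: vec_eq_iff mdiff_mat)

lemma time_domain_UNIV: "time_domain UNIV"
  by unfold_locales simp

lemma time_domain_Icc: "a < b \<Longrightarrow> time_domain {a..b}"
  by unfold_locales (auto simp: trivial_limit_within islimpt_Icc)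

section \<open>Polynomial matrices\<close>

lemma poly_adjoint_mult: "poly_adjoint (A ** B) = poly_adjoint B ** poly_adjoint A"
  by (simp add: poly_adjoint_def matrix_matrix_mult_def vec_eq_iff pcompose_sum pcompose_mult
      mult.commute)

lemma poly_adjoint_add: "poly_adjoint (A + B) = poly_adjoint A + poly_adjoint B"
  by (simp add: poly_adjoint_def vec_eq_iff pcompose_add)

lemma poly_adjoint_mat: "poly_adjoint (mat q) = mat (pcompose q [:0, -1:])"
  by (simp add: poly_adjoint_def mat_def vec_eq_iff)

text \<open>The inverse is the adjugate divided by the determinant. This works over any commutative
  ring in which the determinant is a unit, hence for polynomial entries.\<close>

lemma right_inverse_det:
  fixes A :: "'a :: comm_ring_1 ^ 'n ^ 'n"
  assumes "det A * c = 1"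
  shows "\<exists>B. A ** B = mat 1"
proof -
  \<comment> \<open>The determinant of \<open>A\<close> with row \<open>i\<close> replaced by the
    unit vector \<open>axis j 1\<close> is the cofactor at \<open>(i, j)\<close>, so
    \<open>B\<close> is \<open>c\<close> times the adjugate.\<close>
  define B where "B = (\<chi> j i. c * det (\<chi> r. if r = i then axis j 1 else A $ r))"
  \<comment> \<open>Laplace expansion along row \<open>i\<close>: the sum is the determinant of
    \<open>A\<close> with row \<open>i\<close> replaced by row \<open>l\<close>, which has two equal
    rows unless \<open>l = i\<close>.\<close>
  have "(\<Sum>j\<in>UNIV. A $ l $ j * det (\<chi> r. if r = i then axis j 1 else A $ r)) =
      (if l = i then det A else 0)" for l i
  proof -
    have "A $ l = (\<Sum>j\<in>UNIV. A $ l $ j *s axis j 1)"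
      by (simp add: vec_eq_iff axis_def if_distrib cong: if_cong)
    then have "det (\<chi> r. if r = i then A $ l else A $ r) =
        det (\<chi> r. if r = i then (\<Sum>j\<in>UNIV. A $ l $ j *s axis j 1) else A $ r)"
      by (simp cong: if_cong)
    also have "\<dots> = (\<Sum>j\<in>UNIV. A $ l $ j * det (\<chi> r. if r = i then axis j 1 else A $ r))"
      by (subst det_linear_row_sum) (simp_all add: det_row_mul)
    finally have "(\<Sum>j\<in>UNIV. A $ l $ j * det (\<chi> r. if r = i then axis j 1 else A $ r)) =
        det (\<chi> r. if r = i then A $ l else A $ r)" ..
    also have "\<dots> = (if l = i then det A else 0)"
    proof (cases "l = i")
      case True
      then have "(\<chi> r. if r = i then A $ l else A $ r) = A" by (simp add: vec_eq_iff)
      with True show ?thesis by simp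
    next
      case False
      then show ?thesis by (simp add: det_identical_rows[of l i] row_def)
    qed
    finally show ?thesis .
  qed
  moreover have "(A ** B) $ l $ i =
      c * (\<Sum>j\<in>UNIV. A $ l $ j * det (\<chi> r. if r = i then axis j 1 else A $ r))" for l i
    by (simp add: B_def matrix_matrix_mult_def sum_distrib_left mult.left_commute)
  ultimately have "(A ** B) $ l $ i = mat 1 $ l $ i" for l i
    using assms by (simp add: mat_def mult.commute)
  then show ?thesis by (metis vec_eq_iff)
qed

lemma unimodular_right_inverse:
  fixes M :: "real poly ^ 'n ^ 'r"
  assumes "unimodular M"
  shows "\<exists>V. M ** V = mat 1"
proof -
  obtain e :: "'r \<Rightarrow> 'n" and c
    where e: "bij e" and c: "c \<noteq> 0" and det: "det (\<chi> i j. M $ i $ e j) = [:c:]"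
    using assms unfolding unimodular_def by blast
  have "det (\<chi> i j. M $ i $ e j) * [:inverse c:] = 1"
    using c by (simp add: det one_pCons)
  from right_inverse_det[OF this] obtain B where B: "(\<chi> i j. M $ i $ e j) ** B = mat 1" ..
  \<comment> \<open>Reordering the columns of \<open>M\<close> by \<open>e\<close> is compensated by
    reordering the rows of \<open>B\<close> by \<open>inv e\<close>.\<close>
  have "M ** (\<chi> j. B $ inv e j) = (\<chi> i j. M $ i $ e j) ** B"
  proof -
    have "(\<Sum>j\<in>UNIV. M $ i $ j * B $ inv e j $ l) = (\<Sum>j\<in>UNIV. M $ i $ e j * B $ j $ l)" for i l
      using sum.reindex_bij_betw[OF e, of "\<lambda>j. M $ i $ j * B $ inv e j $ l"] bij_is_inj[OF e]
      by simp
    then show ?thesis by (simp add: matrix_matrix_mult_def vec_eq_iff)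
  qed
  with B show ?thesis by metis
qed

section \<open>Block matrices and the Bezout identity\<close>

lemma sum_UNIV_Plus:
  "(\<Sum>j\<in>UNIV. f j) = (\<Sum>j\<in>UNIV. f (Inl j)) + (\<Sum>j\<in>UNIV. f (Inr j))"
  for f :: "'a::finite + 'b::finite \<Rightarrow> 'c::comm_monoid_add"
  by (subst UNIV_Plus_UNIV[symmetric], subst sum.Plus) (simp_all add: o_def)

definition stack :: "'a ^ 'n ^ 'r \<Rightarrow> 'a ^ 'n ^ 's \<Rightarrow> 'a ^ 'n ^ ('r + 's)" where
  "stack A B = (\<chi> i. case i of Inl k \<Rightarrow> A $ k | Inr k \<Rightarrow> B $ k)"

lemma stack_nth [simp]: "stack A B $ Inl i = A $ i" "stack A B $ Inr j = B $ j"
  by (simp_all add: stack_def)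

lemma block_matrix_eq_block_row: "block_matrix A B C D = block_row (stack A C) (stack B D)"
  by (simp add: block_matrix_def block_row_def stack_def vec_eq_iff split: sum.split)

lemma matrix_mult_block_row: "A ** block_row B C = block_row (A ** B) (A ** C)"
  by (simp add: block_row_def matrix_matrix_mult_def vec_eq_iff split: sum.split)

lemma block_row_mult_stack: "block_row A B ** stack C D = A ** C + B ** D"
  by (simp add: block_row_def matrix_matrix_mult_def vec_eq_iff sum_UNIV_Plus)

lemma block_row_eq_iff: "block_row A B = block_row C D \<longleftrightarrow> A = C \<and> B = D"
  by (auto simp: block_row_def vec_eq_iff split: sum.splits)

lemma stack_exhaust: "\<exists>A B. M = stack A B"
  by (rule exI[of _ "\<chi> i. M $ Inl i"], rule exI[of _ "\<chi> i. M $ Inr i"])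
    (simp add: stack_def vec_eq_iff split: sum.split)

text \<open>With \<open>U = [L K]\<close> and \<open>U V = 1\<close>, the first block row of
  \<open>V\<close> is \<open>R\<close> itself, since \<open>R = (R U) V = [I 0] V\<close>.
  Multiplying out \<open>U V = 1\<close> by blocks then gives the Bezout identity.\<close>

lemma bezout_decomposition:
  fixes R :: "real poly ^ 'q ^ 'g" and L :: "real poly ^ 'g ^ 'q" and K :: "real poly ^ 'm ^ 'q"
  assumes "unimodular (block_row L K)" and "R ** block_row L K = block_row (mat 1) 0"
  obtains H where "R ** K = 0" and "L ** R + K ** H = mat 1"
proof -
  obtain V1 V2 where V: "block_row L K ** stack V1 V2 = mat 1"
    using unimodular_right_inverse[OF assms(1)] stack_exhaust by metis
  have RK: "R ** K = 0"
    using assms(2) by (simp add: matrix_mult_block_row block_row_eq_iff)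
  have "R = R ** (block_row L K ** stack V1 V2)" by (simp add: V)
  also have "\<dots> = V1"
    unfolding matrix_mul_assoc assms(2) by (simp add: block_row_mult_stack)
  finally show thesis
    using that RK V by (simp add: block_row_mult_stack)
qed

section \<open>Integration by parts on a compact interval\<close>

locale compact_interval =
  fixes a b :: real
  assumes a_less_b: "a < b"
begin

sublocale time_domain "{a..b}"
  using a_less_b by (rule time_domain_Icc)

definition ip :: "(real \<Rightarrow> real) \<Rightarrow> (real \<Rightarrow> real) \<Rightarrow> real" where
  "ip f g = integral {a..b} (\<lambda>t. f t * g t)"

text \<open>The index counts the orders that vanish at both ends: \<open>flat 0\<close> is mere
  smoothness, \<open>flat 1\<close> adds vanishing values. Flatness of order \<open>n\<close> is
  what \<open>n\<close> integrations by parts consume.\<close>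

definition flat :: "nat \<Rightarrow> (real \<Rightarrow> real) \<Rightarrow> bool" where
  "flat n f \<longleftrightarrow> smooth_on {a..b} f \<and>
     (\<forall>j<n. nderiv {a..b} j f a = 0 \<and> nderiv {a..b} j f b = 0)"

lemma a_le_b [simp]: "a \<le> b"
  using a_less_b by simp

lemma end_points [simp]: "a \<in> {a..b}" "b \<in> {a..b}"
  using a_less_b by auto

lemma ip_commute: "ip f g = ip g f"
  by (simp add: ip_def mult.commute)

lemma ip_cong:
  "(\<And>t. t \<in> {a..b} \<Longrightarrow> f t = f' t) \<Longrightarrow> (\<And>t. t \<in> {a..b} \<Longrightarrow> g t = g' t) \<Longrightarrow> ip f g = ip f' g'"
  unfolding ip_def by (rule integral_cong) simp

lemma smooth_mult_integrable:
  fixes f g :: "real \<Rightarrow> real"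
  shows "smooth_on {a..b} f \<Longrightarrow> smooth_on {a..b} g \<Longrightarrow> (\<lambda>t. f t * g t) integrable_on {a..b}"
  by (rule integrable_continuous_real) (intro continuous_on_mult smooth_on_imp_continuous_on)

lemma ip_add_cmult:
  assumes "smooth_on {a..b} f" "smooth_on {a..b} g" "smooth_on {a..b} h"
  shows "ip (\<lambda>t. f t + c * g t) h = ip f h + c * ip g h"
proof -
  note i = smooth_mult_integrable[OF assms(1,3)] smooth_mult_integrable[OF assms(2,3)]
  have "integral {a..b} (\<lambda>t. f t * h t + c * (g t * h t)) = ip f h + c * ip g h"
    unfolding ip_def using i
    by (subst integral_add) (auto intro: integrable_on_mult_right)
  then show ?thesis by (simp add: ip_def algebra_simps)
qed

lemma ip_cmult: "ip (\<lambda>t. c * f t) g = c * ip f g"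
  by (simp add: ip_def mult.assoc)

lemma ip_sum:
  assumes "\<And>j. j \<in> A \<Longrightarrow> smooth_on {a..b} (f j)" "smooth_on {a..b} h" "finite A"
  shows "ip (\<lambda>t. \<Sum>j\<in>A. f j t) h = (\<Sum>j\<in>A. ip (f j) h)"
  unfolding ip_def sum_distrib_right
  using assms smooth_mult_integrable by (intro integral_sum) auto

text \<open>If the square is not integrable, its integral is 0 by convention.\<close>

lemma ip_self_nonneg: "0 \<le> ip f f"
proof (cases "(\<lambda>t. f t * f t) integrable_on {a..b}")
  case True
  then show ?thesis unfolding ip_def by (rule integral_nonneg) simp
qed (simp add: ip_def not_integrable_integral)

text \<open>The vanishing of \<open>g\<close> alone removes both boundary terms, so \<open>f\<close>
  stays free at the end points.\<close>

lemma ip_by_parts: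
  assumes "smooth_on {a..b} f" "flat 1 g"
  shows "ip (nderiv {a..b} 1 f) g = - ip f (nderiv {a..b} 1 g)"
proof -
  have g: "smooth_on {a..b} g" "g a = 0" "g b = 0" using assms(2) by (auto simp: flat_def)
  let ?f' = "nderiv {a..b} 1 f" and ?g' = "nderiv {a..b} 1 g"
  have "((\<lambda>t. f t * g t) has_vector_derivative f t * ?g' t + ?f' t * g t) (at t within {a..b})"
    if "t \<in> {a..b}" for t
    using that nderiv_has_vector_derivative[OF assms(1), of t 0]
      nderiv_has_vector_derivative[OF g(1), of t 0]
    by (auto intro!: has_vector_derivative_mult)
  then have "((\<lambda>t. f t * ?g' t + ?f' t * g t) has_integral f b * g b - f a * g a) {a..b}"
    using a_less_b by (intro fundamental_theorem_of_calculus) auto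
  then have "integral {a..b} (\<lambda>t. f t * ?g' t + ?f' t * g t) = 0"
    using g by (simp add: integral_unique)
  then show ?thesis
    using smooth_mult_integrable[OF assms(1) smooth_on_nderiv[OF g(1)]]
      smooth_mult_integrable[OF smooth_on_nderiv[OF assms(1)] g(1)]
    by (simp add: ip_def integral_add)
qed

section \<open>Functions vanishing to finite order at both end points\<close>

lemma flat_smooth: "flat n f \<Longrightarrow> smooth_on {a..b} f"
  by (simp add: flat_def)

lemma flat_mono: "flat n f \<Longrightarrow> m \<le> n \<Longrightarrow> flat m f"
  by (simp add: flat_def)

lemma flat_nderiv: "flat (n + l) f \<Longrightarrow> flat n (nderiv {a..b} l f)"
  by (auto simp: flat_def smooth_on_nderiv simp flip: nderiv_add_index)

lemma flat_pdiff: "flat (n + degree q) f \<Longrightarrow> flat n (pdiff {a..b} q f)"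
  by (auto simp: flat_def smooth_pdiff intro!: sum.neutral)

lemma flat_sum:
  assumes "\<And>j. j \<in> A \<Longrightarrow> flat n (f j)"
  shows "flat n (\<lambda>t. \<Sum>j\<in>A. f j t)"
proof -
  have f: "smooth_on {a..b} (f j)" if "j \<in> A" for j
    using assms[OF that] by (rule flat_smooth)
  show ?thesis
    using assms unfolding flat_def
    by (simp add: smooth_sum(1)[of A f] smooth_sum(2)[of A f] f)
qed

lemma flat_cmult: "flat n f \<Longrightarrow> flat n (\<lambda>t. c * f t)"
  by (auto simp: flat_def smooth_cmult)

text \<open>In the Leibniz expansion of a derivative of order below \<open>n + m\<close>, every term
  has fewer than \<open>n\<close> derivatives on \<open>f\<close> or fewer than \<open>m\<close> on
  \<open>g\<close>. The case \<open>m = 1\<close> raises the order of a weight, and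
  \<open>m = 0\<close> multiplies by a smooth function.\<close>

lemma flat_mult:
  assumes "flat n f" "flat m g" "m \<le> 1"
  shows "flat (n + m) (\<lambda>t. f t * g t)"
proof -
  have s: "smooth_on {a..b} f" "smooth_on {a..b} g" using assms by (auto simp: flat_def)
  have "nderiv {a..b} i f c * nderiv {a..b} (j - i) g c = 0"
    if "c = a \<or> c = b" "i \<le> j" "j < n + m" for i j c
  proof (cases "i < n")
    case True
    then show ?thesis using assms(1) that by (auto simp: flat_def)
  next
    case False
    then have "j - i < m" using that assms(3) by linarith
    then show ?thesis using assms(2) that by (auto simp: flat_def)
  qed
  then show ?thesis
    unfolding flat_def using s by (auto simp: smooth_mult mult.assoc intro!: sum.neutral)
qed

lemma ip_nderiv:
  assumes "smooth_on {a..b} f" "flat n g"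
  shows "ip (nderiv {a..b} n f) g = (- 1) ^ n * ip f (nderiv {a..b} n g)"
  using assms
proof (induction n arbitrary: f)
  case 0
  then show ?case by simp
next
  case (Suc n)
  have "flat n g" by (rule flat_mono[OF Suc.prems(2)]) simp
  then have "ip (nderiv {a..b} n (nderiv {a..b} 1 f)) g =
      (- 1) ^ n * ip (nderiv {a..b} 1 f) (nderiv {a..b} n g)"
    using Suc smooth_on_nderiv by blast
  also have "ip (nderiv {a..b} 1 f) (nderiv {a..b} n g) =
      - ip f (nderiv {a..b} 1 (nderiv {a..b} n g))"
    using Suc.prems by (intro ip_by_parts flat_nderiv) simp_all
  finally show ?case
    using nderiv_add_index[of "{a..b}" n 1 f] nderiv_add_index[of "{a..b}" 1 n g] by simp
qed

text \<open>Substituting \<open>- s\<close> multiplies the \<open>i\<close>-th coefficient by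
  \<open>(- 1) ^ i\<close>, which cancels the sign from \<open>i\<close> integrations by parts. Only
  \<open>g\<close> has to be flat.\<close>

lemma ip_pdiff_adjoint:
  assumes "smooth_on {a..b} f" "flat (degree q) g"
  shows "ip (pdiff {a..b} (pcompose q [:0, -1:]) f) g = ip f (pdiff {a..b} q g)"
proof -
  let ?n = "degree q"
  have g: "smooth_on {a..b} g" by (rule flat_smooth[OF assms(2)])
  have adj: "pdiff {a..b} (pcompose q [:0, -1:]) f =
      (\<lambda>t. \<Sum>i\<le>?n. coeff (pcompose q [:0, -1:]) i * nderiv {a..b} i f t)"
    by (rule ext, rule pdiff_eq_sum) (simp add: degree_pcompose)
  have "ip (pdiff {a..b} (pcompose q [:0, -1:]) f) g =
      (\<Sum>i\<le>?n. coeff (pcompose q [:0, -1:]) i * ip (nderiv {a..b} i f) g)"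
    unfolding adj using assms(1) g by (subst ip_sum) (auto simp: ip_cmult smooth_cmult smooth_on_nderiv)
  also have "\<dots> = (\<Sum>i\<le>?n. coeff q i * ip (nderiv {a..b} i g) f)"
  proof (intro sum.cong refl)
    fix i assume "i \<in> {..?n}"
    then have "ip (nderiv {a..b} i f) g = (- 1) ^ i * ip f (nderiv {a..b} i g)"
      using ip_nderiv[OF assms(1) flat_mono[OF assms(2)]] by simp
    then show "coeff (pcompose q [:0, -1:]) i * ip (nderiv {a..b} i f) g =
        coeff q i * ip (nderiv {a..b} i g) f"
      by (simp add: coeff_pcompose_linear ip_commute[of f] mult.left_commute
          flip: power_mult_distrib mult.assoc)
  qed
  also have "\<dots> = ip (pdiff {a..b} q g) f"
    unfolding pdiff_def[abs_def] using assms(1) g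
    by (subst ip_sum) (auto simp: ip_cmult smooth_cmult smooth_on_nderiv)
  finally show ?thesis by (simp add: ip_commute)
qed

text \<open>Column \<open>j\<close> of \<open>M\<close> acts on component \<open>j\<close> of
  \<open>g\<close>, so the degrees in that column govern how flat the component must be, as in
  \<open>enough_derivatives\<close>.\<close>

lemma ip_mdiff_adjoint:
  fixes M :: "real poly ^ 'n ^ 'r"
  assumes "smooth_on {a..b} f" "\<And>i j. flat (degree (M $ i $ j)) (\<lambda>t. g t $ j)"
  shows "(\<Sum>j\<in>UNIV. ip (\<lambda>t. mdiff {a..b} (poly_adjoint M) f t $ j) (\<lambda>t. g t $ j)) =
    (\<Sum>i\<in>UNIV. ip (\<lambda>t. f t $ i) (\<lambda>t. mdiff {a..b} M g t $ i))"
proof -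
  note f = smooth_component(1)[OF assms(1)]
  have g: "smooth_on {a..b} (\<lambda>t. g t $ j)" for j
    using assms(2) by (rule flat_smooth)
  have "ip (\<lambda>t. mdiff {a..b} (poly_adjoint M) f t $ j) (\<lambda>t. g t $ j) =
      (\<Sum>i\<in>UNIV. ip (\<lambda>t. f t $ i) (pdiff {a..b} (M $ i $ j) (\<lambda>t. g t $ j)))" for j
    unfolding mdiff_def poly_adjoint_def
    by (simp add: ip_sum smooth_pdiff f g ip_pdiff_adjoint[OF f assms(2)])
  moreover have "ip (\<lambda>t. f t $ i) (\<lambda>t. mdiff {a..b} M g t $ i) =
      (\<Sum>j\<in>UNIV. ip (\<lambda>t. f t $ i) (pdiff {a..b} (M $ i $ j) (\<lambda>t. g t $ j)))" for i
    unfolding mdiff_def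
    by (simp add: ip_commute[of "\<lambda>t. f t $ i"] ip_sum smooth_pdiff f g)
  ultimately show ?thesis by simp (rule sum.swap)
qed

lemma flat_mdiff:
  fixes M :: "real poly ^ 'n ^ 'r"
  assumes "\<And>j. flat (n + d) (\<lambda>t. g t $ j)" "\<And>i j. degree (M $ i $ j) \<le> d"
  shows "flat n (\<lambda>t. mdiff {a..b} M g t $ i)"
  unfolding mdiff_def
  by (simp, intro flat_sum flat_pdiff flat_mono[OF assms(1)]) (simp add: assms(2))

text \<open>The weight is \<open>((t - a) * (b - t)) ^ n\<close>, built factor by factor because
  each factor raises the order of vanishing by one.\<close>

lemma exists_flat_weight:
  obtains \<phi> where "flat n \<phi>" "\<And>t. t \<in> {a<..<b} \<Longrightarrow> 0 < \<phi> t"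
proof -
  have "\<exists>\<phi>. flat n \<phi> \<and> (\<forall>t\<in>{a<..<b}. 0 < \<phi> t)"
  proof (induction n)
    case 0
    have "flat 0 (\<lambda>_. 1)" by (simp add: flat_def smooth_const)
    then show ?case by force
  next
    case (Suc n)
    then obtain \<phi> where \<phi>: "flat n \<phi>" "\<forall>t\<in>{a<..<b}. 0 < \<phi> t" by blast
    have "flat 1 (\<lambda>t. (t - a) * (b - t))"
      using smooth_mult(1)[OF smooth_diff(1)[OF smooth_ident smooth_const(1)]
          smooth_diff(1)[OF smooth_const(1) smooth_ident]]
      by (simp add: flat_def)
    from flat_mult[OF \<phi>(1) this] have "flat (Suc n) (\<lambda>t. \<phi> t * ((t - a) * (b - t)))" by simp
    then show ?case using \<phi>(2) by (intro exI[of _ "\<lambda>t. \<phi> t * ((t - a) * (b - t))"]) auto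
  qed
  then show thesis using that by blast
qed

text \<open>A continuous nonnegative function with zero integral vanishes. Inside the interval the
  weight is positive, so \<open>f\<close> is zero there; continuity settles the end points.\<close>

lemma ip_weighted_square_eq_0:
  assumes "\<And>t. t \<in> {a<..<b} \<Longrightarrow> 0 < \<phi> t" "smooth_on {a..b} \<phi>" "smooth_on {a..b} f"
    and "ip f (\<lambda>t. \<phi> t * f t) = 0" "t \<in> {a..b}"
  shows "f t = 0"
proof -
  have cont: "continuous_on {a..b} (\<lambda>t. \<phi> t * (f t)\<^sup>2)" "continuous_on {a..b} f"
    "continuous_on {a..b} \<phi>"
    using smooth_on_imp_continuous_on[OF assms(2)] smooth_on_imp_continuous_on[OF assms(3)]
    by (auto intro!: continuous_intros)
  have nonneg: "0 \<le> \<phi> t" if "t \<in> {a..b}" for t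
  proof (rule continuous_ge_on_Ioo[OF cont(3) _ a_less_b that])
    show "0 \<le> \<phi> s" if "s \<in> {a<..<b}" for s using assms(1)[OF that] by simp
  qed
  have int: "integral {a..b} (\<lambda>t. \<phi> t * (f t)\<^sup>2) = 0"
    using assms(4) by (simp add: ip_def power2_eq_square mult.left_commute)
  have prod0: "\<phi> t * (f t)\<^sup>2 = 0" if "t \<in> {a..b}" for t
    using integral_eq_0_iff[OF cont(1) a_less_b] nonneg int that by auto
  then have zero: "f s = 0" if "s \<in> {a<..<b}" for s
    using prod0[of s] that assms(1)[OF that] by auto
  have "0 \<le> f t" "0 \<le> - f t"
    using continuous_ge_on_Ioo[OF cont(2) _ a_less_b assms(5), of 0]
      continuous_ge_on_Ioo[OF continuous_on_minus[OF cont(2)] _ a_less_b assms(5), of 0] zero by auto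
  then show ?thesis by simp
qed

end

section \<open>The quadratic optimization problem\<close>

text \<open>The exponent is written \<open>i + i\<close> so that the derivative splits into two
  halves, one of which is later moved to the other factor.\<close>

lemma sobolev_poly_eq: "sobolev_poly k = (\<Sum>i\<le>k. monom ((- 1) ^ i) (i + i))"
proof -
  have "[:0, 0, -1:] = (monom (- 1) 2 :: real poly)"
    by (simp add: monom_altdef numeral_2_eq_2 one_pCons)
  moreover have "pcompose (monom 1 i) q = q ^ i" for q :: "real poly" and i
    by (induction i) (simp_all add: monom_Suc pcompose_pCons pcompose_1)
  ultimately have "pcompose (monom 1 i) [:0, 0, -1:] = (monom ((- 1) ^ i) (i + i) :: real poly)" for i
    by (simp add: monom_power mult_2)
  then show ?thesis by (simp add: sobolev_poly_def pcompose_sum)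
qed

lemma pdiff_monom: "pdiff S (monom c n) f t = c * nderiv S n f t"
proof -
  have "pdiff S (monom c n) f t = (\<Sum>i\<le>n. (if i = n then c else 0) * nderiv S i f t)"
    by (subst pdiff_eq_sum[OF degree_monom_le]) (auto intro!: sum.cong)
  also have "\<dots> = c * nderiv S n f t"
    by (simp add: if_distrib[of "\<lambda>x. x * _"] cong: if_cong)
  finally show ?thesis .
qed

context compact_interval
begin

abbreviation D :: "real poly \<Rightarrow> (real \<Rightarrow> real) \<Rightarrow> real \<Rightarrow> real" where
  "D \<equiv> pdiff {a..b}"

text \<open>Moving \<open>i\<close> of the \<open>i + i\<close> derivatives across produces a sign
  that cancels \<open>(- 1) ^ i\<close>. The result is the Sobolev inner product, from which
  positivity and symmetry can be read off.\<close>

lemma ip_sobolev: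
  assumes "smooth_on {a..b} e" "flat k f"
  shows "ip (D (sobolev_poly k) e) f = (\<Sum>i\<le>k. ip (nderiv {a..b} i e) (nderiv {a..b} i f))"
proof -
  have "ip (D (sobolev_poly k) e) f =
      ip (\<lambda>t. \<Sum>i\<le>k. (- 1) ^ i * nderiv {a..b} i (nderiv {a..b} i e) t) f"
    by (intro ip_cong) (simp_all add: sobolev_poly_eq pdiff_poly_sum pdiff_monom nderiv_add_index)
  also have "\<dots> = (\<Sum>i\<le>k. (- 1) ^ i * ip (nderiv {a..b} i (nderiv {a..b} i e)) f)"
    using assms(1) flat_smooth[OF assms(2)]
    by (subst ip_sum) (auto simp: ip_cmult smooth_cmult smooth_on_nderiv)
  also have "\<dots> = (\<Sum>i\<le>k. ip (nderiv {a..b} i e) (nderiv {a..b} i f))"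
  proof (intro sum.cong refl)
    fix i assume "i \<in> {..k}"
    then have "ip (nderiv {a..b} i (nderiv {a..b} i e)) f =
        (- 1) ^ i * ip (nderiv {a..b} i e) (nderiv {a..b} i f)"
      using assms smooth_on_nderiv by (intro ip_nderiv flat_mono[OF assms(2)]) auto
    then show "(- 1) ^ i * ip (nderiv {a..b} i (nderiv {a..b} i e)) f =
        ip (nderiv {a..b} i e) (nderiv {a..b} i f)"
      by (simp flip: power_mult_distrib mult.assoc)
  qed
  finally show ?thesis .
qed

lemma ip_sobolev_nonneg: "flat k e \<Longrightarrow> 0 \<le> ip (D (sobolev_poly k) e) e"
  by (auto simp: ip_sobolev flat_smooth ip_self_nonneg intro: sum_nonneg)

lemma ip_sobolev_commute:
  "flat k e \<Longrightarrow> flat k f \<Longrightarrow> ip (D (sobolev_poly k) e) f = ip (D (sobolev_poly k) f) e"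
  by (simp only: ip_sobolev flat_smooth) (simp only: ip_commute)

lemma ip_sobolev_add_cmult:
  assumes e: "flat k e" and d: "flat k d"
  shows "ip (D (sobolev_poly k) (\<lambda>t. e t + c * d t)) (\<lambda>t. e t + c * d t) =
    ip (D (sobolev_poly k) e) e + 2 * c * ip (D (sobolev_poly k) e) d +
    c\<^sup>2 * ip (D (sobolev_poly k) d) d"
proof -
  let ?Q = "D (sobolev_poly k)" and ?v = "\<lambda>t. e t + c * d t"
  have s: "smooth_on {a..b} e" "smooth_on {a..b} d" using e d by (auto intro: flat_smooth)
  note q = smooth_pdiff(1)[OF s(1), of "sobolev_poly k"] smooth_pdiff(1)[OF s(2), of "sobolev_poly k"]
  have v: "smooth_on {a..b} ?v" by (intro smooth_add smooth_cmult s)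
  have split: "ip f ?v = ip f e + c * ip f d" if "smooth_on {a..b} f" for f
    using ip_add_cmult[OF s that] by (simp add: ip_commute[of f])
  have "ip (?Q ?v) ?v = ip (\<lambda>t. ?Q e t + c * ?Q d t) ?v"
    by (intro ip_cong) (simp_all add: pdiff_add pdiff_cmult s smooth_cmult)
  also have "\<dots> = ip (?Q e) ?v + c * ip (?Q d) ?v"
    by (rule ip_add_cmult[OF q v])
  also have "\<dots> = ip (?Q e) e + 2 * c * ip (?Q e) d + c\<^sup>2 * ip (?Q d) d"
    using ip_sobolev_commute[OF e d] by (simp add: split q algebra_simps power2_eq_square)
  finally show ?thesis .
qed

section \<open>The cost of a vector function and its first variation\<close>

definition energy :: "nat \<Rightarrow> real poly \<Rightarrow> (real \<Rightarrow> real ^ 'n) \<Rightarrow> real" where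
  "energy k p w = 1/2 * integral {a..b} (\<lambda>t. mdiff {a..b} (mat (sobolev_poly k))
     (mdiff {a..b} (mat p) w) t \<bullet> mdiff {a..b} (mat p) w t)"

text \<open>This is \<open>Op\<^sup>* Q Op w\<close>, the gradient of \<open>energy\<close> with
  respect to variations that are flat enough at the end points.\<close>

definition euler :: "nat \<Rightarrow> real poly \<Rightarrow> (real \<Rightarrow> real ^ 'n) \<Rightarrow> real \<Rightarrow> real ^ 'n" where
  "euler k p w = mdiff {a..b} (poly_adjoint (mat p))
     (mdiff {a..b} (mat (sobolev_poly k)) (mdiff {a..b} (mat p) w))"

lemma smooth_euler: "smooth_on {a..b} w \<Longrightarrow> smooth_on {a..b} (euler k p w)"
  by (simp add: euler_def smooth_mdiff)

lemma euler_nth: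
  "euler k p w t $ i = D (pcompose p [:0, -1:]) (D (sobolev_poly k) (D p (\<lambda>t. w t $ i))) t"
  by (simp add: euler_def poly_adjoint_mat mdiff_mat[abs_def])

lemma energy_eq:
  assumes "smooth_on {a..b} w"
  shows "energy k p w =
    (\<Sum>i\<in>UNIV. ip (D (sobolev_poly k) (D p (\<lambda>t. w t $ i))) (D p (\<lambda>t. w t $ i)) / 2)"
proof -
  note s = smooth_pdiff(1)[OF smooth_component(1)[OF assms]]
  have "energy k p w = 1/2 * integral {a..b} (\<lambda>t. \<Sum>i\<in>UNIV.
      D (sobolev_poly k) (D p (\<lambda>t. w t $ i)) t * D p (\<lambda>t. w t $ i) t)"
    by (simp add: energy_def inner_vec_def mdiff_mat[abs_def])
  also have "\<dots> = (\<Sum>i\<in>UNIV. ip (D (sobolev_poly k) (D p (\<lambda>t. w t $ i))) (D p (\<lambda>t. w t $ i)) / 2)"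
    by (subst integral_sum)
      (simp_all add: smooth_mult_integrable smooth_pdiff s ip_def sum_divide_distrib)
  finally show ?thesis .
qed

lemma energy_nonneg:
  assumes "smooth_on {a..b} d" "\<And>i. flat k (D p (\<lambda>t. d t $ i))"
  shows "0 \<le> energy k p d"
  unfolding energy_eq[OF assms(1)] by (intro sum_nonneg) (simp add: ip_sobolev_nonneg assms)

text \<open>Since \<open>p(D) w\<close> is flat at the end points, the boundary terms vanish although \<open>w\<close> itself is
  not flat there.\<close>

lemma energy_variation:
  fixes w d :: "real \<Rightarrow> real ^ 'n"
  assumes w: "smooth_on {a..b} w" "\<And>i. flat k (D p (\<lambda>t. w t $ i))"
    and d: "\<And>i. flat (degree p + k) (\<lambda>t. d t $ i)"
  shows "energy k p (\<lambda>t. w t + c *\<^sub>R d t) =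
    energy k p w + c * (\<Sum>i\<in>UNIV. ip (\<lambda>t. euler k p w t $ i) (\<lambda>t. d t $ i)) + c\<^sup>2 * energy k p d"
proof -
  let ?w = "\<lambda>i t. w t $ i" and ?d = "\<lambda>i t. d t $ i"
  note ws = smooth_component(1)[OF w(1)]
  have ds: "smooth_on {a..b} (?d i)" for i using d by (rule flat_smooth)
  have dsv: "smooth_on {a..b} d" by (intro smooth_vecI ds)
  have vs: "smooth_on {a..b} (\<lambda>t. w t + c *\<^sub>R d t)"
    by (intro smooth_vecI) (simp add: smooth_add smooth_cmult ws ds)
  have pd: "flat k (D p (?d i))" for i
    using d by (intro flat_pdiff) (simp add: add.commute)
  have "ip (D (sobolev_poly k) (D p (\<lambda>t. (w t + c *\<^sub>R d t) $ i))) (D p (\<lambda>t. (w t + c *\<^sub>R d t) $ i)) / 2 =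
      ip (D (sobolev_poly k) (D p (?w i))) (D p (?w i)) / 2 +
      c * ip (\<lambda>t. euler k p w t $ i) (?d i) +
      c\<^sup>2 * (ip (D (sobolev_poly k) (D p (?d i))) (D p (?d i)) / 2)" for i
  proof -
    let ?e = "\<lambda>t. D p (?w i) t + c * D p (?d i) t"
    have e: "D p (\<lambda>t. (w t + c *\<^sub>R d t) $ i) t = ?e t" if "t \<in> {a..b}" for t
      using that by (simp add: pdiff_add pdiff_cmult ws ds smooth_cmult)
    have es: "smooth_on {a..b} ?e"
      by (intro smooth_add smooth_cmult smooth_pdiff ws ds)
    have "ip (D (sobolev_poly k) (D p (\<lambda>t. (w t + c *\<^sub>R d t) $ i))) (D p (\<lambda>t. (w t + c *\<^sub>R d t) $ i)) =
        ip (D (sobolev_poly k) ?e) ?e"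
      by (intro ip_cong pdiff_cong[OF es] e)
    also have "\<dots> = ip (D (sobolev_poly k) (D p (?w i))) (D p (?w i)) +
        2 * c * ip (D (sobolev_poly k) (D p (?w i))) (D p (?d i)) +
        c\<^sup>2 * ip (D (sobolev_poly k) (D p (?d i))) (D p (?d i))"
      by (rule ip_sobolev_add_cmult[OF w(2) pd])
    also have "ip (D (sobolev_poly k) (D p (?w i))) (D p (?d i)) =
        ip (\<lambda>t. euler k p w t $ i) (?d i)"
      unfolding euler_nth
      by (rule ip_pdiff_adjoint[symmetric]) (intro smooth_pdiff ws, rule flat_mono[OF d], simp)
    finally show ?thesis by linarith
  qed
  then show ?thesis
    by (simp only: energy_eq[OF vs] energy_eq[OF w(1)] energy_eq[OF dsv] sum.distrib sum_distrib_left)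
qed

text \<open>With \<open>L R + K H = 1\<close>, the condition \<open>K\<^sup>* g = 0\<close> gives \<open>g = R\<^sup>* (L\<^sup>* g)\<close>: \<open>L\<^sup>* g\<close> is the
  Lagrange multiplier of the constraint \<open>R(D) d = 0\<close>.\<close>

lemma orthogonal_to_kernel:
  fixes R :: "real poly ^ 'q ^ 'g" and L :: "real poly ^ 'g ^ 'q"
    and K :: "real poly ^ 'm ^ 'q" and H :: "real poly ^ 'q ^ 'm"
  assumes bezout: "L ** R + K ** H = mat 1"
    and g: "smooth_on {a..b} g" "\<And>t. t \<in> {a..b} \<Longrightarrow> mdiff {a..b} (poly_adjoint K) g t = 0"
    and d: "\<And>i j. flat (degree (R $ i $ j)) (\<lambda>t. d t $ j)"
      "\<And>t. t \<in> {a..b} \<Longrightarrow> mdiff {a..b} R d t = 0"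
  shows "(\<Sum>j\<in>UNIV. ip (\<lambda>t. g t $ j) (\<lambda>t. d t $ j)) = 0"
proof -
  define l where "l = mdiff {a..b} (poly_adjoint L) g"
  have l: "smooth_on {a..b} l" unfolding l_def by (rule smooth_mdiff[OF g(1)])
  have zero: "smooth_on {a..b} (\<lambda>t. 0 :: real ^ 'm)" by (rule smooth_const)
  have "g t = mdiff {a..b} (poly_adjoint R) l t" if t: "t \<in> {a..b}" for t
  proof -
    have "g t = mdiff {a..b} (poly_adjoint (L ** R + K ** H)) g t"
      by (simp add: bezout poly_adjoint_mat pcompose_1)
    also have "\<dots> = mdiff {a..b} (poly_adjoint R) l t +
        mdiff {a..b} (poly_adjoint H) (mdiff {a..b} (poly_adjoint K) g) t"
      by (simp only: poly_adjoint_add poly_adjoint_mult mdiff_poly_add mdiff_mult[OF g(1) t] l_def)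
    also have "mdiff {a..b} (poly_adjoint H) (mdiff {a..b} (poly_adjoint K) g) t =
        mdiff {a..b} (poly_adjoint H) (\<lambda>t. 0) t"
      by (rule mdiff_cong[OF zero g(2) t])
    also have "\<dots> = 0"
      using mdiff_cmult[OF zero t, of _ 0] by simp
    finally show ?thesis by simp
  qed
  then have "(\<Sum>j\<in>UNIV. ip (\<lambda>t. g t $ j) (\<lambda>t. d t $ j)) =
      (\<Sum>j\<in>UNIV. ip (\<lambda>t. mdiff {a..b} (poly_adjoint R) l t $ j) (\<lambda>t. d t $ j))"
    by (intro sum.cong ip_cong) simp_all
  also have "\<dots> = (\<Sum>i\<in>UNIV. ip (\<lambda>t. l t $ i) (\<lambda>t. mdiff {a..b} R d t $ i))"
    by (rule ip_mdiff_adjoint[OF l d(1)])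
  also have "\<dots> = (\<Sum>i\<in>UNIV. ip (\<lambda>t. l t $ i) (\<lambda>t. 0))"
    using d(2) by (intro sum.cong ip_cong) simp_all
  finally show ?thesis by (simp add: ip_def)
qed

section \<open>Necessity and sufficiency of the stationarity equation\<close>

lemma degree_bound:
  fixes M :: "real poly ^ 'n ^ 'r"
  obtains d where "\<And>i j. degree (M $ i $ j) \<le> d"
proof
  show "degree (M $ i $ j) \<le> (\<Sum>i\<in>UNIV. \<Sum>j\<in>UNIV. degree (M $ i $ j))" for i j
    by (rule order_trans[OF member_le_sum[of j UNIV] member_le_sum[of i UNIV]]) simp_all
qed

text \<open>This is the fundamental lemma of the calculus of variations for test functions in the
  image of \<open>K(D)\<close>: the test function is the residual itself, cut off by a flat
  weight.\<close>

lemma adjoint_eq_0: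
  fixes K :: "real poly ^ 'm ^ 'q"
  assumes g: "smooth_on {a..b} g"
    and orth: "\<And>z. (\<And>j. flat n (\<lambda>t. z t $ j)) \<Longrightarrow>
      (\<Sum>i\<in>UNIV. ip (\<lambda>t. g t $ i) (\<lambda>t. mdiff {a..b} K z t $ i)) = 0"
    and t: "t \<in> {a..b}"
  shows "mdiff {a..b} (poly_adjoint K) g t = 0"
proof -
  obtain d where d: "\<And>i j. degree (K $ i $ j) \<le> d" using degree_bound[of K] by blast
  \<comment> \<open>The order \<open>n + d\<close> covers both the order \<open>n\<close> demanded
    by \<open>orth\<close> and the degrees of \<open>K\<close> in the integration by parts.\<close>
  obtain \<phi> where \<phi>: "flat (n + d) \<phi>" "\<And>t. t \<in> {a<..<b} \<Longrightarrow> 0 < \<phi> t"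
    using exists_flat_weight by blast
  define f where "f = mdiff {a..b} (poly_adjoint K) g"
  define z where "z = (\<lambda>t. \<phi> t *\<^sub>R f t)"
  have f: "smooth_on {a..b} (\<lambda>t. f t $ j)" for j
    unfolding f_def by (intro smooth_component smooth_mdiff g)
  have "flat (n + d) (\<lambda>t. z t $ j)" for j
    using flat_mult[OF \<phi>(1), of 0 "\<lambda>t. f t $ j"] f by (simp add: z_def flat_def)
  then have z: "flat n (\<lambda>t. z t $ j)" "flat (degree (K $ i $ j)) (\<lambda>t. z t $ j)" for i j
    by (rule flat_mono, use d[of i j] in simp)+
  have "(\<Sum>j\<in>UNIV. ip (\<lambda>t. f t $ j) (\<lambda>t. \<phi> t * f t $ j)) =
      (\<Sum>j\<in>UNIV. ip (\<lambda>t. f t $ j) (\<lambda>t. z t $ j))"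
    by (simp add: z_def)
  also have "\<dots> = (\<Sum>i\<in>UNIV. ip (\<lambda>t. g t $ i) (\<lambda>t. mdiff {a..b} K z t $ i))"
    unfolding f_def by (rule ip_mdiff_adjoint[OF g z(2)])
  also have "\<dots> = 0" by (rule orth[OF z(1)])
  finally have sum0: "(\<Sum>j\<in>UNIV. ip (\<lambda>t. f t $ j) (\<lambda>t. \<phi> t * f t $ j)) = 0" .
  have \<phi>_nonneg: "0 \<le> \<phi> t" if "t \<in> {a..b}" for t
    using continuous_ge_on_Ioo[OF smooth_on_imp_continuous_on[OF flat_smooth[OF \<phi>(1)]] _ a_less_b that, of 0]
      \<phi>(2) by (simp add: less_imp_le)
  have "0 \<le> ip (\<lambda>t. f t $ j) (\<lambda>t. \<phi> t * f t $ j)" for j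
    unfolding ip_def
    by (rule integral_nonneg)
      (auto intro!: smooth_mult_integrable smooth_mult flat_smooth[OF \<phi>(1)] f
        simp: mult.left_commute[of _ "\<phi> _"] \<phi>_nonneg)
  \<comment> \<open>Nonnegative terms with zero sum are all zero, so the components can be treated
    one by one.\<close>
  with sum0 have ip0: "ip (\<lambda>t. f t $ j) (\<lambda>t. \<phi> t * f t $ j) = 0" for j
    by (simp add: sum_nonneg_eq_0_iff)
  have "f t $ j = 0" for j
    by (rule ip_weighted_square_eq_0[OF \<phi>(2) flat_smooth[OF \<phi>(1)] f ip0 t])
  then show ?thesis by (simp add: f_def vec_eq_iff)
qed

lemma linear_term_eq_0:
  fixes B C :: real
  assumes "\<And>c. 0 \<le> c * B + c\<^sup>2 * C"
  shows "B = 0"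
proof (rule ccontr)
  assume "B \<noteq> 0"
  \<comment> \<open>With \<open>\<bar>C\<bar> = s - 1\<close> and \<open>c = - B / s\<close> the
    quadratic is at most \<open>- (B / s)\<^sup>2\<close>, which is negative.\<close>
  define s where "s = \<bar>C\<bar> + 1"
  have s: "0 < s" "\<bar>C\<bar> = s - 1" by (simp_all add: s_def)
  define c where "c = - B / s"
  have "c * B + c\<^sup>2 * C \<le> c * B + c\<^sup>2 * \<bar>C\<bar>" by (simp add: mult_left_mono)
  also have "\<dots> = - (B / s)\<^sup>2"
    using s(1) by (simp add: s(2) c_def field_simps power2_eq_square)
  also have "\<dots> < 0" using \<open>B \<noteq> 0\<close> s(1) by simp
  finally show False using assms[of c] by simp
qed

text \<open>Stationarity is also sufficient because the quadratic term of the variation is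
  nonnegative. Equal boundary data are expressed by flatness of \<open>v - w\<close>; flatness of
  \<open>p(D) w\<close> is what contact with trajectories of the type provides.\<close>

theorem optimal_iff:
  fixes R :: "real poly ^ 'q ^ 'g" and L :: "real poly ^ 'g ^ 'q"
    and K :: "real poly ^ 'm ^ 'q" and H :: "real poly ^ 'q ^ 'm" and r :: "'q \<Rightarrow> nat"
  assumes RK: "R ** K = 0" and bezout: "L ** R + K ** H = mat 1"
    and enough: "enough_derivatives k p R r"
    and w: "smooth_on {a..b} w" "\<And>i. flat k (D p (\<lambda>t. w t $ i))"
  shows "(\<forall>t\<in>{a..b}. mdiff {a..b} R w t = 0) \<and>
      (\<forall>v. smooth_on {a..b} v \<and> (\<forall>t\<in>{a..b}. mdiff {a..b} R v t = 0) \<and>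
         (\<forall>i. flat (Suc (r i)) (\<lambda>t. v t $ i - w t $ i)) \<longrightarrow> energy k p w \<le> energy k p v) \<longleftrightarrow>
    (\<exists>\<eta>. smooth_on {a..b} \<eta> \<and> (\<forall>t\<in>{a..b}. w t = mdiff {a..b} K \<eta> t \<and>
       mdiff {a..b} (poly_adjoint K) (euler k p (mdiff {a..b} K \<eta>)) t = 0))"
    (is "?kernel w \<and> ?min \<longleftrightarrow> (\<exists>\<eta>. ?param \<eta>)")
proof -
  have enough1: "degree p + k \<le> Suc (r j)" "degree (R $ i $ j) \<le> Suc (r j)" for i j
    using enough by (auto simp: enough_derivatives_def)
  have kernel: "?kernel (mdiff {a..b} K z)" if "smooth_on {a..b} z" for z
    using that by (simp flip: mdiff_mult add: RK)
  \<comment> \<open>Agreement of \<open>w\<close> and \<open>K(D) \<eta>\<close> on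
    \<open>{a..b}\<close> suffices, since derivatives within the interval depend on nothing
    else.\<close>
  have euler_cong: "euler k p (mdiff {a..b} K \<eta>) t = euler k p w t"
    if "smooth_on {a..b} \<eta>" "\<And>t. t \<in> {a..b} \<Longrightarrow> w t = mdiff {a..b} K \<eta> t" "t \<in> {a..b}" for \<eta> t
    unfolding euler_def using that w(1)
    by (intro mdiff_cong smooth_mdiff) simp_all
  show ?thesis
  proof
    assume lhs: "?kernel w \<and> ?min"
    \<comment> \<open>All real multiples of an admissible \<open>d\<close> are admissible, so the
      energy gap is a quadratic in \<open>c\<close> that is nowhere negative; its linear coefficient
      must vanish.\<close>
    have orth: "(\<Sum>i\<in>UNIV. ip (\<lambda>t. euler k p w t $ i) (\<lambda>t. d t $ i)) = 0"
      if d: "\<And>i. flat (Suc (r i)) (\<lambda>t. d t $ i)" "?kernel d" for d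
    proof (rule linear_term_eq_0)
      fix c :: real
      let ?v = "\<lambda>t. w t + c *\<^sub>R d t"
      have ds: "smooth_on {a..b} d" by (intro smooth_vecI flat_smooth[OF d(1)])
      have cds: "smooth_on {a..b} (\<lambda>t. c *\<^sub>R d t)"
        by (intro smooth_bounded_linear(1)[OF ds] bounded_linear_scaleR_right)
      have "smooth_on {a..b} ?v" by (rule smooth_add(1)[OF w(1) cds])
      moreover have "?kernel ?v"
        using lhs d(2) by (simp add: mdiff_add[OF w(1) cds] mdiff_cmult[OF ds])
      moreover have "flat (Suc (r i)) (\<lambda>t. ?v t $ i - w t $ i)" for i
        using flat_cmult[OF d(1)] by simp
      ultimately have "energy k p w \<le> energy k p ?v" using lhs by blast
      also have "\<dots> = energy k p w +
          c * (\<Sum>i\<in>UNIV. ip (\<lambda>t. euler k p w t $ i) (\<lambda>t. d t $ i)) + c\<^sup>2 * energy k p d"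
        by (rule energy_variation[OF w flat_mono[OF d(1) enough1(1)]])
      finally show "0 \<le> c * (\<Sum>i\<in>UNIV. ip (\<lambda>t. euler k p w t $ i) (\<lambda>t. d t $ i)) +
          c\<^sup>2 * energy k p d"
        by simp
    qed
    \<comment> \<open>Applying \<open>L R + K H = 1\<close> to \<open>w\<close> and using
      \<open>R(D) w = 0\<close> leaves \<open>w = K(D) (H(D) w)\<close>.\<close>
    define \<eta> where "\<eta> = mdiff {a..b} H w"
    have \<eta>: "smooth_on {a..b} \<eta>" unfolding \<eta>_def by (rule smooth_mdiff[OF w(1)])
    have w_eq: "w t = mdiff {a..b} K \<eta> t" if t: "t \<in> {a..b}" for t
    proof -
      have zero: "smooth_on {a..b} (\<lambda>t. 0 :: real ^ 'g)" by (rule smooth_const)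
      have "w t = mdiff {a..b} (L ** R + K ** H) w t" by (simp add: bezout)
      also have "\<dots> = mdiff {a..b} L (mdiff {a..b} R w) t + mdiff {a..b} K \<eta> t"
        by (simp only: mdiff_poly_add mdiff_mult[OF w(1) t] \<eta>_def)
      also have "mdiff {a..b} L (mdiff {a..b} R w) t = mdiff {a..b} L (\<lambda>t. 0) t"
        using lhs by (intro mdiff_cong[OF zero _ t]) simp
      also have "\<dots> = 0"
        using mdiff_cmult[OF zero t, of _ 0] by simp
      finally show ?thesis by simp
    qed
    obtain e where e: "\<And>i j. degree (K $ i $ j) \<le> e" using degree_bound[of K] by blast
    \<comment> \<open>The sum of all \<open>Suc (r i)\<close> is a common bound for the required
      orders; \<open>e\<close> pays for the derivatives taken by \<open>K(D)\<close>.\<close>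
    have "(\<Sum>i\<in>UNIV. ip (\<lambda>t. euler k p w t $ i) (\<lambda>t. mdiff {a..b} K z t $ i)) = 0"
      if z: "\<And>j. flat ((\<Sum>i\<in>UNIV. Suc (r i)) + e) (\<lambda>t. z t $ j)" for z
    proof (rule orth)
      show "flat (Suc (r i)) (\<lambda>t. mdiff {a..b} K z t $ i)" for i
        by (rule flat_mono[OF flat_mdiff[OF z e]]) (rule member_le_sum, simp_all)
      show "?kernel (mdiff {a..b} K z)"
        by (intro kernel smooth_vecI flat_smooth[OF z])
    qed
    then have el_w: "mdiff {a..b} (poly_adjoint K) (euler k p w) t = 0" if "t \<in> {a..b}" for t
      using adjoint_eq_0[OF smooth_euler[OF w(1)] _ that] by blast
    have "mdiff {a..b} (poly_adjoint K) (euler k p (mdiff {a..b} K \<eta>)) t = 0"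
      if "t \<in> {a..b}" for t
      using mdiff_cong[OF smooth_euler[OF w(1)] euler_cong[OF \<eta> w_eq] that, where M = "poly_adjoint K"] el_w[OF that] by simp
    with \<eta> w_eq show "\<exists>\<eta>. ?param \<eta>" by blast
  next
    assume "\<exists>\<eta>. ?param \<eta>"
    then obtain \<eta> where \<eta>: "smooth_on {a..b} \<eta>"
      and w_eq: "\<And>t. t \<in> {a..b} \<Longrightarrow> w t = mdiff {a..b} K \<eta> t"
      and el: "\<And>t. t \<in> {a..b} \<Longrightarrow>
        mdiff {a..b} (poly_adjoint K) (euler k p (mdiff {a..b} K \<eta>)) t = 0"
      by blast
    have el_w: "mdiff {a..b} (poly_adjoint K) (euler k p w) t = 0" if "t \<in> {a..b}" for t
      using mdiff_cong[OF smooth_euler[OF w(1)] euler_cong[OF \<eta> w_eq] that, where M = "poly_adjoint K"] el[OF that] by simp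
    have w_kernel: "?kernel w"
      using mdiff_cong[OF smooth_mdiff[OF \<eta>] w_eq, where M = R] kernel[OF \<eta>] by simp
    moreover have "energy k p w \<le> energy k p v"
      if v: "smooth_on {a..b} v" "?kernel v" "\<And>i. flat (Suc (r i)) (\<lambda>t. v t $ i - w t $ i)" for v
    proof -
      define d where "d = (\<lambda>t. v t - w t)"
      have d: "flat (Suc (r i)) (\<lambda>t. d t $ i)" for i using v(3) by (simp add: d_def)
      have ds: "smooth_on {a..b} d" by (intro smooth_vecI flat_smooth[OF d])
      \<comment> \<open>The competitor is the variation of \<open>w\<close> by \<open>d\<close> with
        \<open>c = 1\<close>, so \<open>energy_variation\<close> applies; its linear term vanishes
        by \<open>orthogonal_to_kernel\<close>.\<close>
      have v_eq: "v = (\<lambda>t. w t + 1 *\<^sub>R d t)" by (simp add: d_def)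
      have "?kernel d"
        using v(2) w_kernel mdiff_add[OF w(1) ds, where M = R] by (simp add: v_eq)
      then have "(\<Sum>i\<in>UNIV. ip (\<lambda>t. euler k p w t $ i) (\<lambda>t. d t $ i)) = 0"
        using orthogonal_to_kernel[OF bezout smooth_euler[OF w(1)] el_w flat_mono[OF d enough1(2)]]
        by blast
      then have "energy k p v = energy k p w + energy k p d"
        unfolding v_eq by (subst energy_variation[OF w flat_mono[OF d enough1(1)]]) simp
      moreover have "0 \<le> energy k p d"
        by (intro energy_nonneg ds flat_pdiff flat_mono[OF d])
          (use enough1(1) in \<open>simp add: add.commute\<close>)
      ultimately show ?thesis by simp
    qed
    ultimately show "?kernel w \<and> ?min" by blast
  qed
qed

end

section \<open>Input/output systems\<close>

text \<open>The sign turns \<open>P(D) y = N(D) u\<close> into \<open>[N P] (- u, y) = 0\<close>, so that the trajectories are the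
  kernel of \<open>[N P]\<close>, which \<open>U\<close> parametrizes.\<close>

definition join :: "(real \<Rightarrow> real ^ 'm) \<Rightarrow> (real \<Rightarrow> real ^ 'g) \<Rightarrow> real \<Rightarrow> real ^ ('m + 'g)" where
  "join u y t = (\<chi> i. case i of Inl k \<Rightarrow> - u t $ k | Inr k \<Rightarrow> y t $ k)"

lemma join_nth [simp]: "join u y t $ Inl i = - u t $ i" "join u y t $ Inr j = y t $ j"
  by (simp_all add: join_def)

lemma join_exhaust: "\<exists>u y. z = join u y"
  by (rule exI[of _ "\<lambda>t. \<chi> i. - z t $ Inl i"], rule exI[of _ "\<lambda>t. \<chi> i. z t $ Inr i"])
    (simp add: join_def vec_eq_iff fun_eq_iff split: sum.split)

lemma all_Plus: "(\<forall>i. Q i) \<longleftrightarrow> (\<forall>i. Q (Inl i)) \<and> (\<forall>i. Q (Inr i))"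
  by (metis sum.exhaust)

text \<open>Translates between competitors that are pairs and competitors that are single vector
  functions.\<close>

lemma all_join: "(\<forall>v. Q v) \<longleftrightarrow> (\<forall>u y. Q (join u y))"
  by (metis join_exhaust)

lemma mdiff_poly_adjoint_stack:
  "mdiff S (poly_adjoint (stack A B)) g t =
    mdiff S (poly_adjoint A) (\<lambda>s. \<chi> i. g s $ Inl i) t + mdiff S (poly_adjoint B) (\<lambda>s. \<chi> i. g s $ Inr i) t"
  by (simp add: mdiff_def poly_adjoint_def vec_eq_iff sum_UNIV_Plus)

lemma mdiff_stack_nth [simp]:
  "mdiff S (stack A B) f t $ Inl i = mdiff S A f t $ i"
  "mdiff S (stack A B) f t $ Inr j = mdiff S B f t $ j"
  by (simp_all add: mdiff_def)

lemma enough_derivatives_block_row: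
  assumes "enough_derivatives k p N ru" "enough_derivatives k p P ry"
  shows "enough_derivatives k p (block_row N P) (case_sum ru ry)"
  using assms by (auto simp: enough_derivatives_def block_row_def split: sum.split)

context time_domain
begin

lemma smooth_join: "smooth_on S (join u y) \<longleftrightarrow> smooth_on S u \<and> smooth_on S y"
proof
  assume s: "smooth_on S (join u y)"
  have "smooth_on S (\<lambda>t. u t $ i)" for i
    using smooth_uminus(1)[OF smooth_component(1)[OF s, of "Inl i"]] by simp
  moreover have "smooth_on S (\<lambda>t. y t $ i)" for i
    using smooth_component(1)[OF s, of "Inr i"] by simp
  ultimately show "smooth_on S u \<and> smooth_on S y" by (simp add: smooth_vecI)
next
  assume s: "smooth_on S u \<and> smooth_on S y"
  have "smooth_on S (\<lambda>t. join u y t $ i)" for i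
    using s by (cases i) (simp_all add: smooth_component smooth_uminus)
  then show "smooth_on S (join u y)" by (rule smooth_vecI)
qed

lemma mdiff_block_row_join:
  assumes "smooth_on S u" "t \<in> S"
  shows "mdiff S (block_row N P) (join u y) t = mdiff S P y t - mdiff S N u t"
  by (simp add: mdiff_def vec_eq_iff sum_UNIV_Plus block_row_def pdiff_uminus
      smooth_component(1)[OF assms(1)] assms(2) sum_negf)

lemma behavior_on_join:
  "(u, y) \<in> behavior_on S P N \<longleftrightarrow>
    smooth_on S (join u y) \<and> (\<forall>t\<in>S. mdiff S (block_row N P) (join u y) t = 0)"
  by (auto simp: behavior_on_def smooth_join mdiff_block_row_join)

text \<open>Only derivatives of \<open>f\<close> up to order \<open>n + degree q\<close> enter, and
  at \<open>t\<close> these agree with those of \<open>g\<close>, which \<open>q(D)\<close>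
  annihilates.\<close>

lemma nderiv_pdiff_contact:
  assumes "smooth_on S f" "smooth_on UNIV g" "\<And>s. pdiff UNIV q g s = 0"
    and "t \<in> S" "\<And>j. j \<le> r \<Longrightarrow> nderiv S j f t = nderiv UNIV j g t" "n + degree q \<le> r"
  shows "nderiv S n (pdiff S q f) t = 0"
proof -
  interpret UNIV: time_domain UNIV by (rule time_domain_UNIV)
  have "nderiv S n (pdiff S q f) t = (\<Sum>i\<le>degree q. coeff q i * nderiv UNIV (n + i) g t)"
    using assms(5,6) by (simp add: smooth_pdiff(2)[OF assms(1,4)])
  also have "\<dots> = nderiv UNIV n (pdiff UNIV q g) t"
    by (simp add: UNIV.smooth_pdiff(2)[OF assms(2)])
  also have "pdiff UNIV q g = (\<lambda>_. 0)" using assms(3) by auto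
  also have "nderiv UNIV n (\<lambda>_. 0 :: real) t = 0" by (simp add: UNIV.smooth_const(2))
  finally show ?thesis .
qed

end

section \<open>Boundary data and cost of joined trajectories\<close>

context compact_interval
begin

text \<open>Since \<open>r\<close> is the highest matched order, \<open>Suc r\<close> orders agree;
  for \<open>n < k\<close> this gives \<open>n + degree q \<le> r\<close>.\<close>

lemma flat_pdiff_contact:
  assumes "smooth_on {a..b} f" "degree q + k \<le> Suc r"
    and "smooth_on UNIV g" "\<And>s. pdiff UNIV q g s = 0"
    and "\<And>j. j \<le> r \<Longrightarrow> nderiv {a..b} j f a = nderiv UNIV j g a"
    and "smooth_on UNIV h" "\<And>s. pdiff UNIV q h s = 0"
    and "\<And>j. j \<le> r \<Longrightarrow> nderiv {a..b} j f b = nderiv UNIV j h b"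
  shows "flat k (D q f)"
  unfolding flat_def using assms(2)
  by (auto intro!: smooth_pdiff assms(1)
      nderiv_pdiff_contact[OF assms(1,3,4) end_points(1) assms(5)]
      nderiv_pdiff_contact[OF assms(1,6,7) end_points(2) assms(8)])

text \<open>The cost is quadratic, so the sign put on the input by \<open>join\<close> has no
  effect.\<close>

lemma cost_eq_energy:
  assumes "smooth_on {a..b} u" "smooth_on {a..b} y"
  shows "cost a b k p (u, y) = energy k p (join u y)"
proof -
  note us = smooth_component(1)[OF assms(1)]
  have neg: "ip (D (sobolev_poly k) (D p (\<lambda>t. - u t $ i))) (D p (\<lambda>t. - u t $ i)) =
      ip (D (sobolev_poly k) (D p (\<lambda>t. u t $ i))) (D p (\<lambda>t. u t $ i))" for i
  proof -
    note pus = smooth_pdiff(1)[OF us]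
    have "ip (D (sobolev_poly k) (D p (\<lambda>t. - u t $ i))) (D p (\<lambda>t. - u t $ i)) =
        ip (D (sobolev_poly k) (\<lambda>t. - D p (\<lambda>t. u t $ i) t)) (\<lambda>t. - D p (\<lambda>t. u t $ i) t)"
      by (intro ip_cong pdiff_cong[OF smooth_uminus(1)[OF pus]] pdiff_uminus[OF us])
    also have "\<dots> = ip (\<lambda>t. - D (sobolev_poly k) (D p (\<lambda>t. u t $ i)) t) (\<lambda>t. - D p (\<lambda>t. u t $ i) t)"
      by (intro ip_cong pdiff_uminus[OF pus] refl)
    finally show ?thesis by (simp add: ip_def)
  qed
  have "cost a b k p (u, y) = energy k p u + energy k p y"
    by (simp add: cost_def energy_def Let_def)
  also have "\<dots> = energy k p (join u y)"
    using assms by (simp add: energy_eq smooth_join sum_UNIV_Plus neg)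
  finally show ?thesis .
qed

text \<open>Comparison with one matching trajectory eliminates \<open>w1\<close> and
  \<open>w2\<close>. The \<open>Suc\<close> arises because contact includes the orders
  \<open>ru i\<close> and \<open>ry i\<close> themselves.\<close>

lemma matches_iff_flat:
  fixes u u' :: "real \<Rightarrow> real ^ 'm" and y y' :: "real \<Rightarrow> real ^ 'g"
  assumes w: "smooth_on {a..b} u" "smooth_on {a..b} y" "matches a b ru ry w1 w2 (u, y)"
    and v: "smooth_on {a..b} u'" "smooth_on {a..b} y'"
  shows "matches a b ru ry w1 w2 (u', y') \<longleftrightarrow>
    (\<forall>i. flat (Suc (case_sum ru ry i)) (\<lambda>t. join u' y' t $ i - join u y t $ i))"
proof -
  obtain u1 y1 u2 y2 where [simp]: "w1 = (u1, y1)" "w2 = (u2, y2)" by fastforce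
  note s = smooth_component(1)[OF w(1)] smooth_component(1)[OF w(2)]
    smooth_component(1)[OF v(1)] smooth_component(1)[OF v(2)]
  have flat_iff: "flat n (\<lambda>t. f t - g t) \<longleftrightarrow>
      (\<forall>j<n. nderiv {a..b} j f a = nderiv {a..b} j g a \<and> nderiv {a..b} j f b = nderiv {a..b} j g b)"
    if "smooth_on {a..b} f" "smooth_on {a..b} g" for f g n
    using that by (simp add: flat_def smooth_diff)
  have "flat (Suc (ru i)) (\<lambda>t. - u' t $ i - - u t $ i) \<longleftrightarrow>
      (\<forall>j\<le>ru i. nderiv {a..b} j (\<lambda>t. u' t $ i) a = nderiv {a..b} j (\<lambda>t. u t $ i) a \<and>
         nderiv {a..b} j (\<lambda>t. u' t $ i) b = nderiv {a..b} j (\<lambda>t. u t $ i) b)" for i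
    by (subst flat_iff) (simp_all add: smooth_uminus s less_Suc_eq_le)
  moreover have "flat (Suc (ry i)) (\<lambda>t. y' t $ i - y t $ i) \<longleftrightarrow>
      (\<forall>j\<le>ry i. nderiv {a..b} j (\<lambda>t. y' t $ i) a = nderiv {a..b} j (\<lambda>t. y t $ i) a \<and>
         nderiv {a..b} j (\<lambda>t. y' t $ i) b = nderiv {a..b} j (\<lambda>t. y t $ i) b)" for i
    by (subst flat_iff) (simp_all add: s less_Suc_eq_le)
  ultimately show ?thesis
    using w(3) by (simp add: all_Plus matches_def contact_def) blast
qed

text \<open>At each end point the trajectory has contact with one that \<open>p(D)\<close>
  annihilates. This supplies the flatness hypothesis of \<open>optimal_iff\<close>.\<close>

lemma matches_imp_flat:
  assumes w: "smooth_on {a..b} u" "smooth_on {a..b} y" "matches a b ru ry w1 w2 (u, y)"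
    and "w1 \<in> op_type P N p" "w2 \<in> op_type P N p"
    and enough: "enough_derivatives k p N ru" "enough_derivatives k p P ry"
  shows "flat k (D p (\<lambda>t. join u y t $ i))"
proof -
  obtain u1 y1 u2 y2 where [simp]: "w1 = (u1, y1)" "w2 = (u2, y2)" by fastforce
  interpret UNIV: time_domain UNIV by (rule time_domain_UNIV)
  have s: "smooth_on UNIV u1" "smooth_on UNIV y1" "smooth_on UNIV u2" "smooth_on UNIV y2"
    and z: "pdiff UNIV p (\<lambda>s. u1 s $ j) t = 0" "pdiff UNIV p (\<lambda>s. y1 s $ l) t = 0"
      "pdiff UNIV p (\<lambda>s. u2 s $ j) t = 0" "pdiff UNIV p (\<lambda>s. y2 s $ l) t = 0" for j l t
    using assms(4,5) by (auto simp: op_type_def behavior_on_def vec_eq_iff mdiff_mat)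
  note sc = s[THEN UNIV.smooth_component(1)]
  show ?thesis
  proof (cases i)
    case (Inl j)
    have "flat k (D p (\<lambda>t. u t $ j))"
      using w(3) enough(1)
      by (intro flat_pdiff_contact[OF smooth_component(1)[OF w(1)] _ sc(1) z(1) _ sc(3) z(3),
            where r = "ru j"])
        (auto simp: matches_def contact_def enough_derivatives_def)
    then have "flat k (\<lambda>t. (- 1) * D p (\<lambda>t. u t $ j) t)" by (rule flat_cmult)
    moreover have "D p (\<lambda>t. - u t $ j) t = (- 1) * D p (\<lambda>t. u t $ j) t" if "t \<in> {a..b}" for t
      using pdiff_uminus[OF smooth_component(1)[OF w(1)] that] by simp
    ultimately have "flat k (D p (\<lambda>t. - u t $ j))"
      using smooth_cong[of "\<lambda>t. (- 1) * D p (\<lambda>t. u t $ j) t" "D p (\<lambda>t. - u t $ j)"]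
      unfolding flat_def by simp
    then show ?thesis by (simp add: Inl)
  next
    case (Inr j)
    have "flat k (D p (\<lambda>t. y t $ j))"
      using w(3) enough(2)
      by (intro flat_pdiff_contact[OF smooth_component(1)[OF w(2)] _ sc(2) z(2) _ sc(4) z(4),
            where r = "ry j"])
        (auto simp: matches_def contact_def enough_derivatives_def)
    then show ?thesis by (simp add: Inr)
  qed
qed

text \<open>Brings the problem into the form of the left-hand side of \<open>optimal_iff\<close>,
  with \<open>R = [N P]\<close>.\<close>

lemma optimal_connection_iff:
  fixes u :: "real \<Rightarrow> real ^ 'm" and y :: "real \<Rightarrow> real ^ 'g"
  assumes w: "smooth_on {a..b} u" "smooth_on {a..b} y" "matches a b ru ry w1 w2 (u, y)"
  shows "optimal_connection a b ru ry k P N p w1 w2 (u, y) \<longleftrightarrow>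
    (\<forall>t\<in>{a..b}. mdiff {a..b} (block_row N P) (join u y) t = 0) \<and>
    (\<forall>v. smooth_on {a..b} v \<and> (\<forall>t\<in>{a..b}. mdiff {a..b} (block_row N P) v t = 0) \<and>
       (\<forall>i. flat (Suc (case_sum ru ry i)) (\<lambda>t. v t $ i - join u y t $ i)) \<longrightarrow>
       energy k p (join u y) \<le> energy k p v)"
  unfolding optimal_connection_def all_join
  using w by (simp add: Ball_def split_paired_All behavior_on_join smooth_join cost_eq_energy
      matches_iff_flat[OF w] cong: conj_cong) blast

text \<open>\<open>Op\<close> and \<open>Q\<close> act componentwise, which is why the equation for
  \<open>\<eta>\<close> is a sum of an input and an output part.\<close>

lemma euler_stack:
  "mdiff {a..b} (poly_adjoint (stack A B)) (euler k p (mdiff {a..b} (stack A B) \<eta>)) t =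
    mdiff {a..b} (poly_adjoint A) (euler k p (mdiff {a..b} A \<eta>)) t +
    mdiff {a..b} (poly_adjoint B) (euler k p (mdiff {a..b} B \<eta>)) t"
proof -
  have "(\<lambda>s. \<chi> i. euler k p (mdiff {a..b} (stack A B) \<eta>) s $ Inl i) = euler k p (mdiff {a..b} A \<eta>)"
    "(\<lambda>s. \<chi> i. euler k p (mdiff {a..b} (stack A B) \<eta>) s $ Inr i) = euler k p (mdiff {a..b} B \<eta>)"
    by (simp_all add: fun_eq_iff vec_eq_iff euler_nth)
  then show ?thesis by (simp add: mdiff_poly_adjoint_stack)
qed

text \<open>The sign in \<open>join\<close> is the origin of the minus in
  \<open>u = - U12 \<eta>\<close>.\<close>

lemma join_eq_mdiff_stack_iff:
  "join u y t = mdiff S (stack A B) \<eta> t \<longleftrightarrow> u t = - mdiff S A \<eta> t \<and> y t = mdiff S B \<eta> t"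
  by (simp add: vec_eq_iff all_Plus) (metis minus_minus)

end

text \<open>The second conjunct describes the restriction to \<open>{a..b}\<close>; the first
  carries the gluing outside the interval and the contact at its end points.\<close>

theorem theorem2:
  fixes P :: "real poly ^ 'g ^ 'g" and N :: "real poly ^ 'm ^ 'g"
    and p :: "real poly" and k :: nat and a b :: real
    and U11 :: "real poly ^ 'g ^ 'm" and U12 :: "real poly ^ 'm ^ 'm"
    and U21 :: "real poly ^ 'g ^ 'g" and U22 :: "real poly ^ 'm ^ 'g"
    and ru :: "'m \<Rightarrow> nat" and ry :: "'g \<Rightarrow> nat"
    and u :: "real \<Rightarrow> real ^ 'm" and y :: "real \<Rightarrow> real ^ 'g"
  assumes "a < b"
    and "det P \<noteq> 0"
    and "proper_transfer P N"
    and "minimal_system P N"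
    and "controllable (behavior_on UNIV P N)"
    and "op_type P N p \<noteq> {}"
    and "unimodular (block_matrix U11 U12 U21 U22)"
    and "block_row N P ** block_matrix U11 U12 U21 U22 = block_row (mat 1) 0"
    and "enough_derivatives k p N ru"
    and "enough_derivatives k p P ry"
  shows "(u, y) \<in> gluskabi_extension a b ru ry k P N p \<longleftrightarrow>
    (\<exists>w1\<in>op_type P N p. \<exists>w2\<in>op_type P N p.
       glued a b w1 w2 (u, y) \<and> matches a b ru ry w1 w2 (u, y)) \<and>
    (\<exists>\<eta> :: real \<Rightarrow> real ^ 'm. smooth_on {a..b} \<eta> \<and>
       (\<forall>t\<in>{a..b}.
          mdiff {a..b} (poly_adjoint U12) (mdiff {a..b} (poly_adjoint (mat p))
            (mdiff {a..b} (mat (sobolev_poly k)) (mdiff {a..b} (mat p)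
              (mdiff {a..b} U12 \<eta>)))) t +
          mdiff {a..b} (poly_adjoint U22) (mdiff {a..b} (poly_adjoint (mat p))
            (mdiff {a..b} (mat (sobolev_poly k)) (mdiff {a..b} (mat p)
              (mdiff {a..b} U22 \<eta>)))) t = 0 \<and>
          u t = - mdiff {a..b} U12 \<eta> t \<and>
          y t = mdiff {a..b} U22 \<eta> t))"
proof -
  interpret compact_interval a b by unfold_locales (rule assms(1))
  define R where "R = block_row N P"
  define L where "L = stack U11 U21"
  define K where "K = stack U12 U22"
  obtain H where RK: "R ** K = 0" and bezout: "L ** R + K ** H = mat 1"
    using bezout_decomposition[of L K R] assms(7,8)
    unfolding R_def L_def K_def block_matrix_eq_block_row by blast
  have enough: "enough_derivatives k p R (case_sum ru ry)"
    unfolding R_def by (rule enough_derivatives_block_row[OF assms(9,10)])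
  define param where "param \<eta> \<longleftrightarrow> smooth_on {a..b} \<eta> \<and> (\<forall>t\<in>{a..b}.
      join u y t = mdiff {a..b} K \<eta> t \<and>
      mdiff {a..b} (poly_adjoint K) (euler k p (mdiff {a..b} K \<eta>)) t = 0)" for \<eta>
  \<comment> \<open>Smoothness of \<open>(u, y)\<close> on the interval is inherited from
    \<open>K(D) \<eta>\<close>, with which it agrees there.\<close>
  have param_smooth: "smooth_on {a..b} u \<and> smooth_on {a..b} y" if "param \<eta>" for \<eta>
    using smooth_cong(1)[OF smooth_mdiff[of \<eta> K], of "join u y"] that
    by (auto simp: param_def smooth_join)
  have optimal: "optimal_connection a b ru ry k P N p w1 w2 (u, y) \<longleftrightarrow>
      matches a b ru ry w1 w2 (u, y) \<and> (\<exists>\<eta>. param \<eta>)"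
    if "w1 \<in> op_type P N p" "w2 \<in> op_type P N p" for w1 w2
  \<comment> \<open>If smoothness or matching fails, both sides are false; otherwise
    \<open>optimal_iff\<close> applies.\<close>
  proof (cases "smooth_on {a..b} u \<and> smooth_on {a..b} y \<and> matches a b ru ry w1 w2 (u, y)")
    case True
    then have w: "smooth_on {a..b} u" "smooth_on {a..b} y" "matches a b ru ry w1 w2 (u, y)"
      by auto
    have "smooth_on {a..b} (join u y)" using w by (simp add: smooth_join)
    from optimal_iff[OF RK bezout enough this matches_imp_flat[OF w that assms(9,10)]] show ?thesis
      using w(3) by (simp only: optimal_connection_iff[OF w] param_def R_def simp_thms)
  next
    case False
    then show ?thesis
      using param_smooth by (auto simp: optimal_connection_def behavior_on_def)
  qed
  \<comment> \<open>\<open>param\<close> does not involve \<open>w1\<close> and \<open>w2\<close>,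
    so the existence of \<open>\<eta>\<close> moves out of their quantifiers.\<close>
  have "(u, y) \<in> gluskabi_extension a b ru ry k P N p \<longleftrightarrow>
    (\<exists>w1\<in>op_type P N p. \<exists>w2\<in>op_type P N p.
       glued a b w1 w2 (u, y) \<and> matches a b ru ry w1 w2 (u, y)) \<and> (\<exists>\<eta>. param \<eta>)"
    using optimal unfolding gluskabi_extension_def by blast
  then show ?thesis
    unfolding param_def K_def euler_stack join_eq_mdiff_stack_iff
    by (simp only: euler_def conj_ac)
qed

end
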